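(* Let $n\ge 1$ be an integer and let $f:(0,\infty)\to\mathbb{R}$ be a differentiable strictly convex function such that $\lim_{x\to 0+}f(x)$ exists and is finite and $f'$ is unbounded from above. Let $\lambda\in(0,1)$. If $\phi:\mathbb{P}_n\to\mathbb{P}_n$ is a surjective map which satisfies $$J_{f,\lambda}\left(\phi(A),\phi(B)\right)=J_{f,\lambda}(A,B)\quad\text{for all } A,B\in\mathbb{P}_n,$$ then there exists a unitary or antiunitary operator $U:\mathbb{C}^n\to\mathbb{C}^n$ such that $$\phi(A)=UAU^*\quad\text{for all } A\in\mathbb{P}_n.$$
   Context: $\mathbb{M}_n$ is the algebra of all $n\times n$ complex matrices, identified with linear operators on $\mathbb{C}^n$; $\mathbb{P}_n\subset\mathbb{M}_n$ is the set of all positive definite matrices. $\operatorname{Tr}$ is the usual trace. For a function $g$ on $(0,\infty)$ and $A\in\mathbb{P}_n$, $g(A)$ is defined by the functional calculus for self-adjoint matrices. For a convex function $f:(0,\infty)\to\mathbb{R}$ and $\lambda\in(0,1)$, the Jensen $\lambda$-$f$-divergence on $\mathbb{P}_n$ is $$J_{f,\lambda}(X,Y)=\operatorname{Tr}\left(\lambda f(X)+(1-\lambda)f(Y)-f\left(\lambda X+(1-\lambda)Y\right)\right),\quad X,Y\in\mathbb{P}_n.$$ An antiunitary operator is a bijective conjugate-linear operator $U$ on $\mathbb{C}^n$ with $\langle Ux,Uy\rangle=\langle y,x\rangle$ for all $x,y$; its adjoint $U^*$ (the conjugate-linear operator with $\langle Ux,y\rangle=\langle U^*y,x\rangle$) equals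 $U^{-1}$, so $UAU^*$ is again a linear operator. *)

theory Defs
  imports "HOL-Analysis.Analysis"
begin

(* The standard Hermitian inner product, linear in the first argument.  The library's
   inner on complex ^ 'n is only its real part. *)
definition cinner :: "complex ^ 'n \<Rightarrow> complex ^ 'n \<Rightarrow> complex" where
  "cinner x y = (\<Sum>i\<in>UNIV. x $ i * cnj (y $ i))"

definition ctranspose :: "complex ^ 'n ^ 'm \<Rightarrow> complex ^ 'm ^ 'n" where
  "ctranspose A = (\<chi> i j. cnj (A $ j $ i))"

definition unitary_matrix :: "complex ^ 'n ^ 'n \<Rightarrow> bool" where
  "unitary_matrix U \<longleftrightarrow> ctranspose U ** U = mat 1 \<and> U ** ctranspose U = mat 1"

definition positive_definite :: "complex ^ 'n ^ 'n \<Rightarrow> bool" where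
  "positive_definite A \<longleftrightarrow>
     ctranspose A = A \<and> (\<forall>x. x \<noteq> 0 \<longrightarrow> 0 < Re (cinner (A *v x) x))"

definition real_diag :: "('n \<Rightarrow> real) \<Rightarrow> complex ^ 'n ^ 'n" where
  "real_diag d = (\<chi> i j. if i = j then of_real (d i) else 0)"

(* Functional calculus for self-adjoint matrices: diagonalise unitarily and apply g to the
   eigenvalues.  Lemma matrix_fun_eq below shows that the result does not depend on the
   chosen diagonalisation.  Only the values of g on the spectrum of A matter, so functions
   on the positive half-line are represented by total functions when A is positive definite. *)
definition matrix_fun :: "(real \<Rightarrow> real) \<Rightarrow> complex ^ 'n ^ 'n \<Rightarrow> complex ^ 'n ^ 'n" where
  "matrix_fun g A = (THE B. \<exists>U d. unitary_matrix U \<and>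
      A = U ** real_diag d ** ctranspose U \<and>
      B = U ** real_diag (\<lambda>i. g (d i)) ** ctranspose U)"

definition strictly_convex_on :: "real set \<Rightarrow> (real \<Rightarrow> real) \<Rightarrow> bool" where
  "strictly_convex_on S f \<longleftrightarrow> convex S \<and>
     (\<forall>x\<in>S. \<forall>y\<in>S. \<forall>t. x \<noteq> y \<and> 0 < t \<and> t < 1 \<longrightarrow>
        f (t * x + (1 - t) * y) < t * f x + (1 - t) * f y)"

definition jensen_div ::
    "(real \<Rightarrow> real) \<Rightarrow> real \<Rightarrow> complex ^ 'n ^ 'n \<Rightarrow> complex ^ 'n ^ 'n \<Rightarrow> complex" where
  "jensen_div f l X Y =
     trace (l *\<^sub>R matrix_fun f X + (1 - l) *\<^sub>R matrix_fun f Y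
            - matrix_fun f (l *\<^sub>R X + (1 - l) *\<^sub>R Y))"

definition conj_linear :: "(complex ^ 'n \<Rightarrow> complex ^ 'm) \<Rightarrow> bool" where
  "conj_linear T \<longleftrightarrow>
     (\<forall>x y. T (x + y) = T x + T y) \<and> (\<forall>c x. T (c *s x) = cnj c *s T x)"

definition unitary_op :: "(complex ^ 'n \<Rightarrow> complex ^ 'n) \<Rightarrow> bool" where
  "unitary_op U \<longleftrightarrow> Vector_Spaces.linear (*s) (*s) U \<and> bij U \<and>
     (\<forall>x y. cinner (U x) (U y) = cinner x y)"

definition antiunitary_op :: "(complex ^ 'n \<Rightarrow> complex ^ 'n) \<Rightarrow> bool" where
  "antiunitary_op U \<longleftrightarrow> conj_linear U \<and> bij U \<and>
     (\<forall>x y. cinner (U x) (U y) = cinner y x)"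

(* Adjoints of linear and of conjugate-linear operators; in both cases the second argument
   is uniquely determined by the first. *)
definition is_adjoint ::
    "(complex ^ 'n \<Rightarrow> complex ^ 'n) \<Rightarrow> (complex ^ 'n \<Rightarrow> complex ^ 'n) \<Rightarrow> bool" where
  "is_adjoint T T' \<longleftrightarrow> Vector_Spaces.linear (*s) (*s) T' \<and>
     (\<forall>x y. cinner (T x) y = cinner x (T' y))"

definition is_conj_adjoint ::
    "(complex ^ 'n \<Rightarrow> complex ^ 'n) \<Rightarrow> (complex ^ 'n \<Rightarrow> complex ^ 'n) \<Rightarrow> bool" where
  "is_conj_adjoint T T' \<longleftrightarrow> conj_linear T' \<and>
     (\<forall>x y. cinner (T x) y = cinner (T' y) x)"

lemma real_diag_mult_left: "(real_diag d ** A) $ i $ j = of_real (d i) * A $ i $ j"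
  by (simp add: real_diag_def matrix_matrix_mult_def if_distrib[where f = "\<lambda>z. z * _"]
      cong: if_cong)

lemma real_diag_mult_right: "(A ** real_diag d) $ i $ j = A $ i $ j * of_real (d j)"
  by (simp add: real_diag_def matrix_matrix_mult_def if_distrib[where f = "\<lambda>z. _ * z"]
      cong: if_cong)

lemma matrix_fun_unique:
  fixes U V :: "complex ^ 'n ^ 'n"
  assumes U: "unitary_matrix U" and V: "unitary_matrix V"
    and eq: "U ** real_diag d ** ctranspose U = V ** real_diag e ** ctranspose V"
  shows "U ** real_diag (\<lambda>i. g (d i)) ** ctranspose U
       = V ** real_diag (\<lambda>i. g (e i)) ** ctranspose V"
proof -
  define W where "W = ctranspose V ** U"
  have WU: "W ** ctranspose U = ctranspose V" and VW: "V ** W = U"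
    using U V
    by (simp_all add: W_def unitary_matrix_def matrix_mul_assoc)
      (simp add: matrix_mul_assoc [symmetric])
  have "W ** real_diag d = ctranspose V ** (U ** real_diag d ** ctranspose U) ** U"
    using U by (simp add: W_def unitary_matrix_def matrix_mul_assoc [symmetric])
  also have "\<dots> = ctranspose V ** V ** real_diag e ** W"
    by (simp add: eq W_def matrix_mul_assoc)
  also have "\<dots> = real_diag e ** W"
    using V by (simp add: unitary_matrix_def)
  finally have comm: "W ** real_diag d = real_diag e ** W" .
  have "W $ i $ j * of_real (g (d j)) = of_real (g (e i)) * W $ i $ j" for i j
  proof (cases "W $ i $ j = 0")
    case False
    have "W $ i $ j * of_real (d j) = of_real (e i) * W $ i $ j"
      using arg_cong [OF comm, of "\<lambda>M. M $ i $ j"]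
      by (simp add: real_diag_mult_left real_diag_mult_right)
    with False have "d j = e i" by simp
    then show ?thesis by simp
  qed simp
  then have comm': "W ** real_diag (\<lambda>i. g (d i)) = real_diag (\<lambda>i. g (e i)) ** W"
    by (simp add: vec_eq_iff real_diag_mult_left real_diag_mult_right)
  have "U ** real_diag (\<lambda>i. g (d i)) ** ctranspose U
      = V ** (W ** real_diag (\<lambda>i. g (d i))) ** ctranspose U"
    by (simp add: VW matrix_mul_assoc)
  also have "\<dots> = V ** real_diag (\<lambda>i. g (e i)) ** (W ** ctranspose U)"
    by (simp add: comm' matrix_mul_assoc)
  finally show ?thesis by (simp add: WU)
qed

lemma matrix_fun_eq:
  assumes "unitary_matrix U" and "A = U ** real_diag d ** ctranspose U"
  shows "matrix_fun g A = U ** real_diag (\<lambda>i. g (d i)) ** ctranspose U"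
  unfolding matrix_fun_def
proof (rule the_equality)
  show "\<exists>V e. unitary_matrix V \<and> A = V ** real_diag e ** ctranspose V \<and>
      U ** real_diag (\<lambda>i. g (d i)) ** ctranspose U
      = V ** real_diag (\<lambda>i. g (e i)) ** ctranspose V"
    using assms by blast
next
  fix B
  assume "\<exists>V e. unitary_matrix V \<and> A = V ** real_diag e ** ctranspose V \<and>
      B = V ** real_diag (\<lambda>i. g (e i)) ** ctranspose V"
  then show "B = U ** real_diag (\<lambda>i. g (d i)) ** ctranspose U"
    using assms matrix_fun_unique by metis
qed

end

(*
The Jensen divergence knows the Loewner order: A <= B iff X |-> J(X,A) - J(X,B) is bounded below.
Writing f as a sum of an increasing and a bounded decreasing convex function, "only if" is trace
monotonicity (Peierls' inequality); for "if", test with X = t v v* + 1, t -> infinity, where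
<Av,v> > <Bv,v>, and use that f' is unbounded. Hence phi is an order automorphism of the positive
definite cone, and it extends to an order automorphism of the positive semidefinite cone which still
preserves J. Elements of rank one are those below which the order is total, so u u* is sent to some
w w*, and |w| = |u| because J(u u*, 0) is preserved. Rank one minorants determine a positive matrix;
comparing those of 1 + v v* and of its image 1 + z z* shows that u |-> w preserves |<u,v>|. By
Wigner's theorem u |-> w is unitary or antiunitary up to phases, and since A and phi(A) have
corresponding rank one minorants, phi is conjugation by this operator.
*)

theory Submission
  imports Defs
begin

section \<open>Hermitian matrices and the Loewner order\<close>

text \<open>The obstacle is that \<phi> lives on the open cone, which has no rank one element once n
  > 1, while Wigner's theorem needs rank one matrices. Passing to the closed cone requires that the
  strict order \<open>\<prec>\<prec>\<close> (positive definite difference) be preserved. This is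
  not part of being an order automorphism and is extracted from limits of decreasing sequences.
  Continuity is needed only along sequences that approach their limit from above in the order; there
  the two monotone parts of f can be squeezed, so continuity of the functional calculus never has to
  be proved. The finite limit of f at 0 is what gives J a meaning on the closed cone. Finally, the
  vector z in the image of 1 + v v* is not known beforehand to be related to the image of v:
  equality of norms has to be won from Cauchy-Schwarz in both directions before the two can be
  identified up to a phase.\<close>

lemma cinner_add_left: "cinner (x + y) z = cinner x z + cinner y z"
  by (simp add: cinner_def algebra_simps sum.distrib)

lemma cinner_add_right: "cinner x (y + z) = cinner x y + cinner x z"
  by (simp add: cinner_def algebra_simps sum.distrib)

lemma cinner_diff_left: "cinner (x - y) z = cinner x z - cinner y z"
  by (simp add: cinner_def algebra_simps sum_subtractf)

lemma cinner_diff_right: "cinner x (y - z) = cinner x y - cinner x z"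
  by (simp add: cinner_def algebra_simps sum_subtractf)

lemma cinner_scale_left [simp]: "cinner (c *s x) y = c * cinner x y"
  by (simp add: cinner_def sum_distrib_left mult.assoc)

lemma cinner_scale_right [simp]: "cinner x (c *s y) = cnj c * cinner x y"
  by (simp add: cinner_def sum_distrib_left mult.left_commute)

lemma cinner_scaleR_left [simp]: "cinner (r *\<^sub>R x) y = of_real r * cinner x y"
  by (simp add: cinner_def sum_distrib_left mult.assoc scaleR_conv_of_real[where 'a = complex])

lemma cinner_scaleR_right [simp]: "cinner x (r *\<^sub>R y) = of_real r * cinner x y"
  by (simp add: cinner_def sum_distrib_left mult.left_commute scaleR_conv_of_real[where 'a = complex])

lemma cinner_zero [simp]: "cinner 0 y = 0" "cinner x 0 = 0"
  by (simp_all add: cinner_def)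

lemma cnj_cinner: "cnj (cinner x y) = cinner y x"
  by (simp add: cinner_def mult.commute)

lemma cmod_cinner_commute: "cmod (cinner x y) = cmod (cinner y x)"
  by (metis cnj_cinner complex_mod_cnj)

lemma Re_cinner: "Re (cinner x y) = inner x y"
  by (simp add: cinner_def inner_vec_def inner_complex_def)

lemma cinner_self: "cinner x x = of_real ((norm x)\<^sup>2)"
proof (rule complex_eqI)
  show "Re (cinner x x) = Re (of_real ((norm x)\<^sup>2))"
    by (simp add: Re_cinner power2_norm_eq_inner)
  show "Im (cinner x x) = Im (of_real ((norm x)\<^sup>2))"
    by (simp add: cinner_def mult.commute)
qed

lemma cinner_self_eq_0 [simp]: "cinner x x = 0 \<longleftrightarrow> x = 0"
  by (simp add: cinner_self)

lemma cinner_mult_mv: "cinner (A *v x) y = cinner x (ctranspose A *v y)"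
proof -
  have "cinner (A *v x) y = (\<Sum>i\<in>UNIV. \<Sum>j\<in>UNIV. A $ i $ j * x $ j * cnj (y $ i))"
    by (simp add: cinner_def matrix_vector_mult_def sum_distrib_right)
  also have "\<dots> = (\<Sum>j\<in>UNIV. \<Sum>i\<in>UNIV. A $ i $ j * x $ j * cnj (y $ i))"
    by (rule sum.swap)
  also have "\<dots> = cinner x (ctranspose A *v y)"
    by (simp add: cinner_def matrix_vector_mult_def ctranspose_def sum_distrib_left mult_ac)
  finally show ?thesis .
qed

lemma ctranspose_ctranspose [simp]: "ctranspose (ctranspose A) = A"
  by (simp add: ctranspose_def vec_eq_iff)

lemma ctranspose_mult: "ctranspose (A ** B) = ctranspose B ** ctranspose A"
  by (simp add: ctranspose_def matrix_matrix_mult_def vec_eq_iff mult.commute)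

lemma ctranspose_add: "ctranspose (A + B) = ctranspose A + ctranspose B"
  by (simp add: ctranspose_def vec_eq_iff)

lemma ctranspose_diff: "ctranspose (A - B) = ctranspose A - ctranspose B"
  by (simp add: ctranspose_def vec_eq_iff)

lemma ctranspose_scaleR: "ctranspose (r *\<^sub>R A) = r *\<^sub>R ctranspose A"
  by (simp add: ctranspose_def vec_eq_iff)

lemma ctranspose_mat1 [simp]: "ctranspose (mat 1) = mat 1"
  by (simp add: ctranspose_def vec_eq_iff mat_def)

lemma ctranspose_zero [simp]: "ctranspose 0 = 0"
  by (simp add: ctranspose_def vec_eq_iff)

lemma ctranspose_real_diag [simp]: "ctranspose (real_diag d) = real_diag d"
  by (auto simp: ctranspose_def vec_eq_iff real_diag_def)

lemmas ctranspose_simps = ctranspose_mult ctranspose_add ctranspose_diff ctranspose_scaleR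

lemma scaleR_mv: "(r *\<^sub>R A) *v x = r *\<^sub>R (A *v x)" for A :: "complex ^ 'n ^ 'm"
  by (simp add: vec_eq_iff matrix_vector_mult_def scaleR_sum_right)

lemma scaleR_vec_of_real: "r *\<^sub>R x = complex_of_real r *s x" for x :: "complex ^ 'n"
  by (simp add: vec_eq_iff scaleR_conv_of_real[where 'a = complex])

lemma mv_axis: "A *v axis j 1 = column j A" for A :: "complex ^ 'n ^ 'm"
  by (simp add: vec_eq_iff matrix_vector_mult_def column_def axis_def if_distrib cong: if_cong)

lemma cinner_axis: "cinner x (axis i 1) = x $ i"
  by (simp add: cinner_def axis_def if_distrib cong: if_cong)

lemma cinner_mv_axis: "cinner (A *v axis j 1) (axis i 1) = A $ i $ j"
  by (simp add: mv_axis cinner_axis column_def)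

text \<open>Turning x by a phase makes the inner product real and nonnegative, where the
  Cauchy-Schwarz inequality of the real inner product applies.\<close>

lemma cmod_cinner_le: "cmod (cinner x y) \<le> norm x * norm y"
proof (cases "cinner x y = 0")
  case False
  define c where "c = cnj (cinner x y) / of_real (cmod (cinner x y))"
  have c: "c * cinner x y = of_real (cmod (cinner x y))" "cmod c = 1"
    using False by (simp_all add: c_def norm_divide complex_norm_square[symmetric]
        power2_eq_square mult.commute[of "cnj _"])
  have "cmod (cinner x y) = Re (cinner (c *s x) y)"
    using c by simp
  also have "\<dots> \<le> norm (c *s x) * norm y"
    by (simp only: Re_cinner norm_cauchy_schwarz)
  also have "norm (c *s x) = norm x"
  proof -
    have "of_real ((norm (c *s x))\<^sup>2) = cinner (c *s x) (c *s x)"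
      by (simp only: cinner_self)
    also have "\<dots> = c * cnj c * cinner x x" by simp
    also have "\<dots> = of_real ((norm x)\<^sup>2)"
      using c(2) complex_norm_square[of c] by (simp add: cinner_self)
    finally show ?thesis by (simp only: of_real_eq_iff) (simp add: power2_eq_iff_nonneg)
  qed
  finally show ?thesis .
qed simp

section \<open>Quadratic forms, the Loewner order and rank one matrices\<close>

definition qf :: "complex ^ 'n ^ 'n \<Rightarrow> complex ^ 'n \<Rightarrow> real" where
  "qf A x = Re (cinner (A *v x) x)"

definition psd :: "complex ^ 'n ^ 'n \<Rightarrow> bool" where
  "psd A \<longleftrightarrow> ctranspose A = A \<and> (\<forall>x. 0 \<le> qf A x)"

definition loewner :: "complex ^ 'n ^ 'n \<Rightarrow> complex ^ 'n ^ 'n \<Rightarrow> bool" (infix "\<preceq>" 50) where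
  "A \<preceq> B \<longleftrightarrow> psd (B - A)"

definition outer :: "complex ^ 'n \<Rightarrow> complex ^ 'n ^ 'n" where
  "outer u = (\<chi> i j. u $ i * cnj (u $ j))"

lemma outer_mv: "outer u *v x = cinner x u *s u"
  by (simp add: outer_def vec_eq_iff matrix_vector_mult_def cinner_def sum_distrib_right
      sum_distrib_left mult_ac)

lemma ctranspose_outer [simp]: "ctranspose (outer u) = outer u"
  by (simp add: outer_def ctranspose_def vec_eq_iff mult.commute)

lemma outer_scaleR: "outer (r *\<^sub>R u) = r\<^sup>2 *\<^sub>R outer u"
  by (simp add: outer_def vec_eq_iff power2_eq_square)

lemma outer_zero [simp]: "outer 0 = 0"
  by (simp add: outer_def vec_eq_iff)

lemma outer_mv_conj: "A ** outer u ** ctranspose A = outer (A *v u)"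
proof -
  have "(A ** outer u ** ctranspose A) $ i $ j = outer (A *v u) $ i $ j" for i j
    by (simp add: outer_def matrix_matrix_mult_def matrix_vector_mult_def ctranspose_def
        sum_distrib_left sum_distrib_right mult_ac)
  then show ?thesis by (simp add: vec_eq_iff)
qed

lemma qf_outer: "qf (outer u) x = (cmod (cinner x u))\<^sup>2"
proof -
  have "cinner x u * cinner u x = of_real ((cmod (cinner x u))\<^sup>2)"
    by (subst (2) cnj_cinner[symmetric]) (simp only: complex_norm_square)
  then show ?thesis by (simp add: qf_def outer_mv)
qed

lemma qf_add: "qf (A + B) x = qf A x + qf B x"
  by (simp add: qf_def matrix_vector_mult_add_rdistrib cinner_add_left)

lemma qf_diff: "qf (A - B) x = qf A x - qf B x"
  by (simp add: qf_def matrix_vector_mult_diff_rdistrib cinner_diff_left)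

lemma qf_scaleR: "qf (r *\<^sub>R A) x = r * qf A x"
  by (simp add: qf_def scaleR_mv)

lemma qf_mat1 [simp]: "qf (mat 1) x = (norm x)\<^sup>2"
  by (simp add: qf_def cinner_self)

lemma qf_zero [simp]: "qf 0 x = 0" "qf A 0 = 0"
  by (simp_all add: qf_def)

lemmas qf_simps = qf_add qf_diff qf_scaleR qf_outer

lemma qf_scale_vec: "qf A (c *s x) = (cmod c)\<^sup>2 * qf A x"
proof -
  have "cinner (A *v (c *s x)) (c *s x) = of_real ((cmod c)\<^sup>2) * cinner (A *v x) x"
    by (simp add: vector_scalar_commute mult_ac complex_norm_square[of c, unfolded of_real_power])
  then show ?thesis by (simp add: qf_def)
qed

lemma qf_scaleR_vec: "qf A (r *\<^sub>R x) = r\<^sup>2 * qf A x"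
  using qf_scale_vec[of A "of_real r" x] by (simp add: scaleR_vec_of_real)

lemma hermitian_cinner_commute:
  "ctranspose A = A \<Longrightarrow> cinner (A *v x) y = cnj (cinner (A *v y) x)"
  by (metis cinner_mult_mv cnj_cinner)

lemma qf_add_vec:
  assumes "ctranspose A = A"
  shows "qf A (x + y) = qf A x + 2 * Re (cinner (A *v x) y) + qf A y"
  using hermitian_cinner_commute[OF assms, of y x]
  by (simp add: qf_def matrix_vector_right_distrib cinner_add_left cinner_add_right)

lemma positive_definite_iff:
  "positive_definite A \<longleftrightarrow> ctranspose A = A \<and> (\<forall>x. x \<noteq> 0 \<longrightarrow> 0 < qf A x)"
  by (simp add: positive_definite_def qf_def)

lemma positive_definite_imp_psd: "positive_definite A \<Longrightarrow> psd A"
  by (metis less_imp_le order_refl positive_definite_iff psd_def qf_zero(2))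

lemma psd_hermitian: "psd A \<Longrightarrow> ctranspose A = A"
  by (simp add: psd_def)

lemma psd_qf: "psd A \<Longrightarrow> 0 \<le> qf A x"
  by (simp add: psd_def)

text \<open>Polarisation. Quadratic forms yield only real parts of the sesquilinear form; the
  imaginary part of an entry is the real part obtained after multiplying the second basis vector by
  \<open>\<i>\<close>.\<close>

lemma hermitian_eqI:
  assumes "ctranspose A = A" "ctranspose B = B" "\<And>x. qf A x = qf B x"
  shows "A = B"
proof -
  have re: "Re (cinner (A *v x) y) = Re (cinner (B *v x) y)" for x y
    using qf_add_vec[OF assms(1), of x y] qf_add_vec[OF assms(2), of x y] assms(3) by simp
  have "A $ i $ j = B $ i $ j" for i j
  proof (rule complex_eqI)
    show "Re (A $ i $ j) = Re (B $ i $ j)"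
      using re[of "axis j 1" "axis i 1"] by (simp add: cinner_mv_axis)
    show "Im (A $ i $ j) = Im (B $ i $ j)"
      using re[of "axis j 1" "\<i> *s axis i 1"] by (simp add: cinner_mv_axis)
  qed
  then show ?thesis by (simp add: vec_eq_iff)
qed

lemma psd_add: "psd A \<Longrightarrow> psd B \<Longrightarrow> psd (A + B)"
  by (simp add: psd_def ctranspose_add qf_add)

lemma psd_scaleR: "psd A \<Longrightarrow> 0 \<le> r \<Longrightarrow> psd (r *\<^sub>R A)"
  by (simp add: psd_def ctranspose_scaleR qf_scaleR)

lemma psd_mat1 [simp]: "psd (mat 1)"
  by (simp add: psd_def)

lemma psd_zero [simp]: "psd 0"
  by (simp add: psd_def)

lemma psd_outer [simp]: "psd (outer u)"
  by (simp add: psd_def qf_outer)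

lemma positive_definite_add_psd: "positive_definite A \<Longrightarrow> psd B \<Longrightarrow> positive_definite (A + B)"
  by (auto simp: positive_definite_iff psd_def ctranspose_add qf_add add_pos_nonneg)

lemma positive_definite_scaleR: "positive_definite A \<Longrightarrow> 0 < r \<Longrightarrow> positive_definite (r *\<^sub>R A)"
  by (simp add: positive_definite_iff ctranspose_scaleR qf_scaleR)

lemma positive_definite_mat1 [simp]: "positive_definite (mat 1)"
  by (simp add: positive_definite_iff)

lemma psd_plus_scalar: "psd A \<Longrightarrow> 0 < r \<Longrightarrow> positive_definite (A + r *\<^sub>R mat 1)"
  by (metis positive_definite_add_psd positive_definite_mat1 positive_definite_scaleR add.commute)

lemma loewner_iff:
  assumes "ctranspose A = A" "ctranspose B = B"
  shows "A \<preceq> B \<longleftrightarrow> (\<forall>x. qf A x \<le> qf B x)"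
  using assms by (simp add: loewner_def psd_def ctranspose_diff qf_diff)

lemma loewner_qf: "A \<preceq> B \<Longrightarrow> qf A x \<le> qf B x"
  by (auto simp: loewner_def psd_def qf_diff)

lemma loewner_refl [simp]: "A \<preceq> A"
  by (simp add: loewner_def)

lemma loewner_trans: "A \<preceq> B \<Longrightarrow> B \<preceq> C \<Longrightarrow> A \<preceq> C"
  using psd_add[of "B - A" "C - B"] by (simp add: loewner_def)

lemma loewner_antisym: "psd A \<Longrightarrow> psd B \<Longrightarrow> A \<preceq> B \<Longrightarrow> B \<preceq> A \<Longrightarrow> A = B"
  by (meson antisym hermitian_eqI loewner_qf psd_hermitian)

lemma loewner_zero: "0 \<preceq> A \<longleftrightarrow> psd A"
  by (simp add: loewner_def)

lemma psd_loewner: "psd A \<Longrightarrow> A \<preceq> B \<Longrightarrow> psd B"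
  using loewner_trans loewner_zero by blast

lemma positive_definite_loewner: "positive_definite A \<Longrightarrow> A \<preceq> B \<Longrightarrow> positive_definite B"
  using positive_definite_add_psd[of A "B - A"] by (simp add: loewner_def)

text \<open>As in the classical proof, a polynomial in a real t is nonnegative, namely the form of A
  at x + t z y. The factor z = <Ax,y> aligns the phases, so that the cross term is 2 t
  |z|^2.\<close>

lemma psd_cauchy_schwarz:
  assumes "psd A"
  shows "(cmod (cinner (A *v x) y))\<^sup>2 \<le> qf A x * qf A y"
proof -
  define z where "z = cinner (A *v x) y"
  have herm: "ctranspose A = A" using assms by (rule psd_hermitian)
  define r where "r = (cmod z)\<^sup>2"
  have poly: "0 \<le> qf A x + 2 * t * r + t\<^sup>2 * r * qf A y" for t
  proof -
    have "z * cnj z = of_real r" by (simp add: r_def flip: complex_norm_square)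
    then have "Re (cinner (A *v x) ((of_real t * z) *s y)) = t * r"
      by (simp add: z_def[symmetric] mult.assoc mult.commute[of "cnj z"])
    moreover have "qf A ((of_real t * z) *s y) = t\<^sup>2 * r * qf A y"
      by (simp add: qf_scale_vec norm_mult power_mult_distrib r_def)
    moreover have "0 \<le> qf A (x + (of_real t * z) *s y)" using assms by (rule psd_qf)
    ultimately show ?thesis by (simp add: qf_add_vec[OF herm])
  qed
  have r0: "0 \<le> r" and y0: "0 \<le> qf A y" and x0: "0 \<le> qf A x"
    using assms by (simp_all add: r_def psd_qf)
  show ?thesis
  proof (cases "qf A y = 0")
    case True
    have "r = 0"
    proof (rule ccontr)
      assume "r \<noteq> 0"
      \<comment> \<open>The polynomial is linear here; its value at this t is - qf A x - 2.\<close>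
      then show False
        using poly[of "- (qf A x + 1) / r"] True x0 by simp
    qed
    then show ?thesis using True by (simp add: r_def z_def)
  next
    case False
    then have pos: "qf A y > 0" using y0 by simp
    \<comment> \<open>The polynomial is smallest at t = -1 / qf A y.\<close>
    have "0 \<le> (qf A x + 2 * (- 1 / qf A y) * r + (- 1 / qf A y)\<^sup>2 * r * qf A y) * qf A y"
      using poly[of "- 1 / qf A y"] pos by (intro mult_nonneg_nonneg) auto
    also have "\<dots> = qf A x * qf A y - r"
      using pos by (simp add: field_simps power2_eq_square)
    finally show ?thesis by (simp add: r_def z_def)
  qed
qed

lemma psd_qf_eq_0_imp: "psd A \<Longrightarrow> qf A x = 0 \<Longrightarrow> A *v x = 0"
  using psd_cauchy_schwarz[of A x "A *v x"] by (simp add: cinner_self)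

section \<open>The spectral theorem\<close>

lemma exists_orthogonal_vector:
  fixes u :: "'n \<Rightarrow> complex ^ 'n"
  assumes "k \<notin> S"
  shows "\<exists>x. x \<noteq> 0 \<and> (\<forall>i\<in>S. cinner x (u i) = 0)"
proof -
  \<comment> \<open>The vectors are indexed by a proper subset of the coordinates, so their
    conjugates can be rows of a square matrix with a zero row left over. A kernel vector of it is
    orthogonal to all of them.\<close>
  define B :: "complex ^ 'n ^ 'n" where "B = (\<chi> i j. if i \<in> S then cnj (u i $ j) else 0)"
  have "row k B = 0" using assms by (simp add: B_def row_def vec_eq_iff)
  then have "det B = 0" by (rule det_zero_row)
  then have "\<not> invertible B" by (simp add: invertible_det_nz)
  then obtain x where x: "B *v x = 0" "x \<noteq> 0"
    by (metis invertible_left_inverse matrix_left_invertible_ker)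
  have "cinner x (u i) = 0" if "i \<in> S" for i
    using arg_cong[OF x(1), of "\<lambda>v. v $ i"] that
    by (simp add: B_def matrix_vector_mult_def cinner_def mult.commute)
  with x show ?thesis by blast
qed

lemma continuous_on_cinner [continuous_intros]:
  "continuous_on S f \<Longrightarrow> continuous_on S g \<Longrightarrow> continuous_on S (\<lambda>x. cinner (f x) (g x))"
  unfolding cinner_def by (intro continuous_intros)

text \<open>Induction on the index set: the orthogonal complement W of the eigenvectors found so far
  is invariant under A, and a maximiser of the quadratic form on its unit sphere is the next
  eigenvector.\<close>

lemma hermitian_eigenbasis_aux:
  fixes A :: "complex ^ 'n ^ 'n"
  assumes herm: "ctranspose A = A" and "finite (S :: 'n set)"
  shows "\<exists>u d. (\<forall>i\<in>S. A *v u i = of_real (d i) *s u i) \<and>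
           (\<forall>i\<in>S. \<forall>j\<in>S. cinner (u i) (u j) = (if i = j then 1 else (0::complex)))"
  using \<open>finite S\<close>
proof induction
  case (insert k S)
  then obtain u :: "'n \<Rightarrow> complex ^ 'n" and d
    where eig: "\<And>i. i \<in> S \<Longrightarrow> A *v u i = of_real (d i) *s u i"
      and on: "\<And>i j. i \<in> S \<Longrightarrow> j \<in> S \<Longrightarrow> cinner (u i) (u j) = (if i = j then 1 else 0)"
    by blast
  define W where "W = {x. \<forall>i\<in>S. cinner x (u i) = 0}"
  have W_scale: "c *s x \<in> W" "r *\<^sub>R x \<in> W" if "x \<in> W" for c r x
    using that by (simp_all add: W_def)
  have W_inv: "A *v x \<in> W" if "x \<in> W" for x
    using that by (simp add: W_def cinner_mult_mv herm eig)
  have "closed W"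
    unfolding W_def Ball_def
    by (intro closed_Collect_all closed_Collect_imp open_Collect_const closed_Collect_eq continuous_intros)
  then have cpt: "compact (W \<inter> sphere 0 1)"
    by (intro closed_Int_compact) auto
  obtain y where y: "y \<noteq> 0" "y \<in> W"
    using exists_orthogonal_vector[OF insert(2), of u] by (auto simp: W_def)
  have "(1 / norm y) *\<^sub>R y \<in> W \<inter> sphere 0 1"
    using y by (simp add: W_scale)
  then have ne: "W \<inter> sphere 0 1 \<noteq> {}" by blast
  have "continuous_on (W \<inter> sphere 0 1) (qf A)"
    unfolding qf_def matrix_vector_mult_def by (intro continuous_intros)
  then obtain x where x: "x \<in> W" "norm x = 1"
    and max: "\<And>z. z \<in> W \<Longrightarrow> norm z = 1 \<Longrightarrow> qf A z \<le> qf A x"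
    using continuous_attains_sup[OF cpt ne, of "qf A"] by auto
  define \<mu> where "\<mu> = qf A x"
  \<comment> \<open>B is known to be nonnegative on W only, so \<open>psd_cauchy_schwarz\<close>
    cannot be quoted; nonnegativity at x + t y with y = B x is exploited directly.\<close>
  define B where "B = \<mu> *\<^sub>R mat 1 - A"
  have Bnn: "0 \<le> qf B z" if "z \<in> W" for z
  proof (cases "z = 0")
    case False
    have "qf A ((1 / norm z) *\<^sub>R z) \<le> \<mu>"
      unfolding \<mu>_def using that False by (intro max) (simp_all add: W_scale)
    then have "qf A z / (norm z)\<^sup>2 \<le> \<mu>"
      by (simp only: qf_scaleR_vec) (simp add: power_divide)
    then show ?thesis using False
      by (simp add: B_def qf_simps field_simps)
  qed simp
  have B_sym: "ctranspose B = B"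
    by (simp add: B_def ctranspose_simps herm)
  have B0: "qf B x = 0" using x by (simp add: B_def qf_simps \<mu>_def)
  define y where "y = B *v x"
  have yW: "y \<in> W"
    using x(1) W_inv[OF x(1)]
    by (simp add: y_def B_def matrix_vector_mult_diff_rdistrib scaleR_mv W_def cinner_diff_left)
  define q where "q = qf B y"
  define r where "r = Re (cinner (B *v x) y)"
  have q: "0 \<le> q" using Bnn yW by (simp add: q_def)
  \<comment> \<open>The minimiser would be - r / q; the added 1 avoids division by zero and still
    gives a negative value unless r = 0.\<close>
  define t where "t = - r / (q + 1)"
  have "x + t *\<^sub>R y \<in> W"
    using x(1) yW by (simp add: W_def cinner_add_left)
  then have "0 \<le> qf B (x + t *\<^sub>R y)" by (rule Bnn)
  also have "\<dots> = 2 * t * r + t\<^sup>2 * q"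
    by (simp add: qf_add_vec[OF B_sym] B0 qf_scaleR_vec r_def[symmetric] q_def[symmetric])
  also have "\<dots> = - (r / (q + 1))\<^sup>2 * (q + 2)"
    using q by (simp add: t_def divide_simps) (simp add: algebra_simps power2_eq_square)
  finally have "(r / (q + 1))\<^sup>2 * (q + 2) \<le> 0" by simp
  then have "r = 0" using q by (simp add: mult_le_0_iff)
  then have "y = 0" by (simp add: r_def y_def cinner_self)
  then have Ax: "A *v x = of_real \<mu> *s x"
    by (simp add: y_def B_def matrix_vector_mult_diff_rdistrib scaleR_mv scaleR_vec_of_real)
  have xu: "cinner x (u i) = 0" "cinner (u i) x = 0" if "i \<in> S" for i
    using x(1) that cnj_cinner[of x "u i"] by (auto simp: W_def)
  have xx: "cinner x x = 1" using x(2) by (simp add: cinner_self)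
  show ?case
  proof (intro exI conjI)
    show "\<forall>i\<in>insert k S. A *v (u(k := x)) i = of_real ((d(k := \<mu>)) i) *s (u(k := x)) i"
      using eig Ax by auto
    show "\<forall>i\<in>insert k S. \<forall>j\<in>insert k S.
        cinner ((u(k := x)) i) ((u(k := x)) j) = (if i = j then 1 else 0)"
      using on xx xu insert(2) by auto
  qed
qed simp

lemma unitary_columns:
  fixes U :: "complex ^ 'n ^ 'n"
  assumes "unitary_matrix U"
  shows "cinner (column i U) (column j U) = (if i = j then 1 else 0)"
proof -
  have "cinner (column i U) (column j U) = cinner (U *v axis i 1) (U *v axis j 1)"
    by (simp add: mv_axis)
  also have "\<dots> = cinner (axis i 1) (axis j 1)"
    using assms by (simp add: cinner_mult_mv unitary_matrix_def matrix_vector_mul_assoc)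
  finally show ?thesis by (simp add: cinner_axis) (simp add: axis_def)
qed

lemma unitary_matrixI_columns:
  fixes u :: "'n \<Rightarrow> complex ^ 'n"
  assumes "\<And>i j. cinner (u i) (u j) = (if i = j then 1 else 0)"
  shows "unitary_matrix (\<chi> i j. u j $ i)"
proof -
  have "ctranspose (\<chi> i j. u j $ i) ** (\<chi> i j. u j $ i) = mat 1"
    using assms by (simp add: vec_eq_iff matrix_matrix_mult_def ctranspose_def mat_def cinner_def
        mult.commute eq_commute[of _ "_::'n"])
  then show ?thesis by (metis unitary_matrix_def matrix_left_right_inverse)
qed

theorem spectral_theorem:
  fixes A :: "complex ^ 'n ^ 'n"
  assumes "ctranspose A = A"
  obtains U d where "unitary_matrix U" "A = U ** real_diag d ** ctranspose U"
proof -
  obtain u :: "'n \<Rightarrow> complex ^ 'n" and d where eig: "\<And>i. A *v u i = of_real (d i) *s u i"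
    and on: "\<And>i j. cinner (u i) (u j) = (if i = j then 1 else 0)"
    using hermitian_eigenbasis_aux[OF assms finite, of UNIV, unfolded ball_UNIV] by blast
  define U where "U = (\<chi> i j. u j $ i)"
  have U: "unitary_matrix U" unfolding U_def using on by (rule unitary_matrixI_columns)
  have "(A ** U) $ i $ j = (U ** real_diag d) $ i $ j" for i j
    using arg_cong[OF eig[of j], of "\<lambda>v. v $ i"]
    by (simp add: real_diag_mult_right) (simp add: U_def matrix_matrix_mult_def matrix_vector_mult_def mult.commute)
  then have "A ** U = U ** real_diag d" by (simp add: vec_eq_iff)
  then have "A ** (U ** ctranspose U) = U ** real_diag d ** ctranspose U"
    by (simp add: matrix_mul_assoc)
  then show ?thesis using U that by (simp add: unitary_matrix_def)
qed

section \<open>Trace functions of positive matrices\<close>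

text \<open>A relation, because neither U nor the enumeration d of the eigenvalues is determined by
  A.\<close>

definition diagonalises :: "complex ^ 'n ^ 'n \<Rightarrow> ('n \<Rightarrow> real) \<Rightarrow> complex ^ 'n ^ 'n \<Rightarrow> bool" where
  "diagonalises U d A \<longleftrightarrow> unitary_matrix U \<and> A = U ** real_diag d ** ctranspose U"

text \<open>For Hermitian A the trace is real already; the real part turns it into a number of type
  \<open>real\<close>, to which inequalities apply.\<close>

definition trf :: "(real \<Rightarrow> real) \<Rightarrow> complex ^ 'n ^ 'n \<Rightarrow> real" where
  "trf g A = Re (trace (matrix_fun g A))"

lemma hermitian_diagonalises:
  assumes "ctranspose A = A"
  obtains U d where "diagonalises U d A"
  using spectral_theorem[OF assms] diagonalises_def by metis

lemma matrix_mult_scaleR: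
  fixes A :: "complex ^ 'n ^ 'm"
  shows "A ** (r *\<^sub>R B) = r *\<^sub>R (A ** B)" "(r *\<^sub>R A) ** B = r *\<^sub>R (A ** B)"
  by (simp_all add: vec_eq_iff matrix_matrix_mult_def scaleR_sum_right)

lemma matrix_mult_add_left: "(A + B) ** C = A ** C + B ** C" for A B :: "complex ^ 'n ^ 'm"
  by (simp add: vec_eq_iff matrix_matrix_mult_def algebra_simps sum.distrib)

lemma diagonalises_affine:
  assumes "diagonalises U d A"
  shows "diagonalises U (\<lambda>i. a * d i + b) (a *\<^sub>R A + b *\<^sub>R mat 1)"
proof -
  have "real_diag (\<lambda>i. a * d i + b) = a *\<^sub>R real_diag d + b *\<^sub>R mat 1"
    by (auto simp: real_diag_def mat_def vec_eq_iff scaleR_conv_of_real[where 'a = complex])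
  then show ?thesis
    using assms
    by (simp add: diagonalises_def matrix_add_ldistrib matrix_mult_add_left matrix_mult_scaleR
        unitary_matrix_def)
qed

lemma diagonalises_hermitian: "diagonalises U d A \<Longrightarrow> ctranspose A = A"
  by (auto simp: diagonalises_def ctranspose_mult matrix_mul_assoc)

lemma diagonalises_matrix_fun:
  "diagonalises U d A \<Longrightarrow> diagonalises U (\<lambda>i. g (d i)) (matrix_fun g A)"
  using matrix_fun_eq by (auto simp: diagonalises_def)

lemma trace_diagonalises:
  assumes "diagonalises U d A"
  shows "trace A = of_real (\<Sum>i\<in>UNIV. d i)"
proof -
  have "trace A = trace (real_diag d ** (ctranspose U ** U))"
    using assms trace_mul_sym[of U "real_diag d ** ctranspose U"]
    by (simp add: diagonalises_def matrix_mul_assoc)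
  also have "\<dots> = of_real (\<Sum>i\<in>UNIV. d i)"
    using assms by (simp add: diagonalises_def unitary_matrix_def) (simp add: trace_def real_diag_def)
  finally show ?thesis .
qed

lemma trf_eq: "diagonalises U d A \<Longrightarrow> trf g A = (\<Sum>i\<in>UNIV. g (d i))"
  by (drule diagonalises_matrix_fun[of _ _ _ g], drule trace_diagonalises) (simp add: trf_def)

lemma diagonalises_eigenvector:
  assumes "diagonalises U d A"
  shows "A *v column i U = of_real (d i) *s column i U"
proof -
  have "A ** U = U ** real_diag d"
    using assms by (auto simp: diagonalises_def unitary_matrix_def simp flip: matrix_mul_assoc)
  then have "column i (A ** U) = column i (U ** real_diag d)" by simp
  then show ?thesis
    by (simp add: vec_eq_iff column_def real_diag_mult_right mult.commute)
      (simp add: matrix_matrix_mult_def matrix_vector_mult_def)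
qed

lemma unitary_column_norm [simp]: "unitary_matrix U \<Longrightarrow> norm (column i U) = 1"
  using unitary_columns[of U i i] norm_ge_zero[of "column i U"]
  by (simp add: cinner_self power2_eq_1_iff flip: of_real_power)

lemma diagonalises_qf_column: "diagonalises U d A \<Longrightarrow> qf A (column i U) = d i"
  by (simp add: qf_def diagonalises_eigenvector cinner_self diagonalises_def)

lemma cinner_expand_unitary:
  fixes U :: "complex ^ 'n ^ 'n"
  assumes "unitary_matrix U"
  shows "cinner x y = (\<Sum>i\<in>UNIV. cinner x (column i U) * cinner (column i U) y)"
proof -
  have c: "(ctranspose U *v z) $ i = cinner z (column i U)" for z i
    by (simp add: matrix_vector_mult_def ctranspose_def cinner_def column_def mult.commute)
  have "cinner x y = cinner (ctranspose U *v x) (ctranspose U *v y)"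
    using assms by (simp add: cinner_mult_mv unitary_matrix_def matrix_vector_mul_assoc)
  also have "\<dots> = (\<Sum>i\<in>UNIV. cinner x (column i U) * cinner (column i U) y)"
    by (simp add: cinner_def[of "ctranspose U *v x"] c cnj_cinner)
  finally show ?thesis .
qed

lemma diagonalises_qf:
  assumes "diagonalises U d A"
  shows "qf A x = (\<Sum>i\<in>UNIV. d i * (cmod (cinner x (column i U)))\<^sup>2)"
proof -
  have "cinner (A *v x) x = (\<Sum>i\<in>UNIV. cinner (A *v x) (column i U) * cinner (column i U) x)"
    using assms by (intro cinner_expand_unitary) (simp add: diagonalises_def)
  also have "\<dots> = (\<Sum>i\<in>UNIV. of_real (d i * (cmod (cinner x (column i U)))\<^sup>2))"
  proof (rule sum.cong [OF refl])
    fix i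
    have "cinner (A *v x) (column i U) = of_real (d i) * cinner x (column i U)"
      by (simp add: cinner_mult_mv diagonalises_hermitian[OF assms] diagonalises_eigenvector[OF assms])
    then show "cinner (A *v x) (column i U) * cinner (column i U) x
        = of_real (d i * (cmod (cinner x (column i U)))\<^sup>2)"
      using complex_norm_square[of "cinner x (column i U)"]
      by (simp add: cnj_cinner mult.assoc)
  qed
  finally show ?thesis by (simp add: qf_def)
qed

lemma norm_expand_unitary:
  fixes U :: "complex ^ 'n ^ 'n"
  assumes "unitary_matrix U"
  shows "(norm x)\<^sup>2 = (\<Sum>i\<in>UNIV. (cmod (cinner x (column i U)))\<^sup>2)"
proof -
  have "real_diag (\<lambda>i. 1) = (mat 1 :: complex ^ 'n ^ 'n)"
    by (simp add: real_diag_def mat_def vec_eq_iff)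
  then have "diagonalises U (\<lambda>i. 1) (mat 1)"
    using assms by (simp add: diagonalises_def unitary_matrix_def)
  from diagonalises_qf[OF this, of x] show ?thesis by simp
qed

lemma diagonalises_psd: "diagonalises U d A \<Longrightarrow> psd A \<longleftrightarrow> (\<forall>i. 0 \<le> d i)"
  by (metis (no_types, lifting) diagonalises_hermitian diagonalises_qf diagonalises_qf_column
      psd_def mult_nonneg_nonneg sum_nonneg zero_le_power2)

lemma diagonalises_positive_definite: "diagonalises U d A \<Longrightarrow> positive_definite A \<Longrightarrow> 0 < d i"
  using diagonalises_qf_column[of U d A i] unitary_column_norm[of U i]
  by (metis diagonalises_def norm_zero positive_definite_iff zero_neq_one)

section \<open>Peierls' inequality and monotone trace functions\<close>

lemma peierls_inequality:
  fixes V :: "complex ^ 'n ^ 'n"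
  assumes A: "diagonalises U d A" and V: "unitary_matrix V"
    and conv: "convex_on S g" and d: "\<And>i. d i \<in> S"
  shows "(\<Sum>i\<in>UNIV. g (qf A (column i V))) \<le> trf g A"
proof -
  \<comment> \<open>These weights form a doubly stochastic matrix: row sums 1 allow Jensen's
    inequality, column sums 1 collapse the double sum.\<close>
  let ?w = "\<lambda>i j. (cmod (cinner (column i V) (column j U)))\<^sup>2"
  have U: "unitary_matrix U" using A by (simp add: diagonalises_def)
  have rows: "(\<Sum>j\<in>UNIV. ?w i j) = 1" for i
    using norm_expand_unitary[OF U, of "column i V"] V by simp
  have cols: "(\<Sum>i\<in>UNIV. ?w i j) = 1" for j
    using norm_expand_unitary[OF V, of "column j U"] U by (simp add: cmod_cinner_commute[of "column j U"])
  have "g (qf A (column i V)) \<le> (\<Sum>j\<in>UNIV. ?w i j * g (d j))" for i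
    using convex_on_sum[OF _ _ conv rows, of i d] d
    by (simp add: diagonalises_qf[OF A] mult.commute)
  then have "(\<Sum>i\<in>UNIV. g (qf A (column i V))) \<le> (\<Sum>i\<in>UNIV. \<Sum>j\<in>UNIV. ?w i j * g (d j))"
    by (intro sum_mono)
  also have "\<dots> = (\<Sum>j\<in>UNIV. (\<Sum>i\<in>UNIV. ?w i j) * g (d j))"
    by (subst sum.swap) (simp add: sum_distrib_right)
  finally show ?thesis by (simp add: cols trf_eq[OF A])
qed

lemma peierls_psd:
  assumes "psd A" "unitary_matrix V" "convex_on {0..} g"
  shows "(\<Sum>i\<in>UNIV. g (qf A (column i V))) \<le> trf g A"
proof -
  obtain U d where A: "diagonalises U d A"
    using assms(1) psd_hermitian hermitian_diagonalises by blast
  show ?thesis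
    using peierls_inequality[OF A assms(2,3)] diagonalises_psd[OF A] assms(1) by simp
qed

text \<open>In the eigenbasis of A the Peierls bound is an equality for A and an inequality for B,
  so only diagonal values have to be compared. Without the trace such monotonicity may fail.\<close>

lemma trf_mono:
  assumes "convex_on {0..} g" "mono_on {0..} g" "psd A" "A \<preceq> B"
  shows "trf g A \<le> trf g B"
proof -
  obtain U d where A: "diagonalises U d A"
    using assms(3) psd_hermitian hermitian_diagonalises by blast
  have B: "psd B" using assms(3,4) by (rule psd_loewner)
  have "trf g A = (\<Sum>i\<in>UNIV. g (qf A (column i U)))"
    by (simp add: trf_eq[OF A] diagonalises_qf_column[OF A])
  also have "\<dots> \<le> (\<Sum>i\<in>UNIV. g (qf B (column i U)))"
    using assms B by (intro sum_mono mono_onD[OF assms(2)]) (auto simp: psd_qf loewner_qf)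
  also have "\<dots> \<le> trf g B"
    using A B assms(1) by (intro peierls_psd) (auto simp: diagonalises_def)
  finally show ?thesis .
qed

text \<open>Here the eigenbasis of the larger matrix B is the right one, since the Peierls
  inequality has to be spent on A.\<close>

lemma trf_antimono:
  assumes "convex_on {0..} g" "antimono_on {0..} g" "psd A" "A \<preceq> B"
  shows "trf g B \<le> trf g A"
proof -
  have B: "psd B" using assms(3,4) by (rule psd_loewner)
  then obtain U d where D: "diagonalises U d B"
    using psd_hermitian hermitian_diagonalises by blast
  have "trf g B = (\<Sum>i\<in>UNIV. g (qf B (column i U)))"
    by (simp add: trf_eq[OF D] diagonalises_qf_column[OF D])
  also have "\<dots> \<le> (\<Sum>i\<in>UNIV. g (qf A (column i U)))"
    using assms B by (intro sum_mono monotone_onD[OF assms(2)]) (auto simp: psd_qf loewner_qf)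
  also have "\<dots> \<le> trf g A"
    using D assms(1,3) by (intro peierls_psd) (auto simp: diagonalises_def)
  finally show ?thesis .
qed

text \<open>The second fact says that column \<open>i0\<close> is v / |v| up to a phase, in a form
  that ignores the phase and includes v = 0. It serves to complete v to an orthonormal
  basis.\<close>

lemma outer_diagonalises:
  fixes v :: "complex ^ 'n"
  obtains U i0 where "diagonalises U (\<lambda>i. if i = i0 then (norm v)\<^sup>2 else 0) (outer v)"
    "\<And>A. qf A v = (norm v)\<^sup>2 * qf A (column i0 U)"
proof -
  obtain U d where D: "diagonalises U d (outer v)"
    using hermitian_diagonalises ctranspose_outer by blast
  have U: "unitary_matrix U" using D by (simp add: diagonalises_def)
  have d: "d i = (cmod (cinner v (column i U)))\<^sup>2" for i
    using diagonalises_qf_column[OF D, of i] by (simp add: qf_outer cmod_cinner_commute)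
  have "\<exists>i0. \<forall>i. i \<noteq> i0 \<longrightarrow> d i = 0"
  proof (rule ccontr)
    assume "\<not> ?thesis"
    then obtain i j where ij: "i \<noteq> j" "d i \<noteq> 0" "d j \<noteq> 0" by metis
    \<comment> \<open>Both eigenvectors would be multiples of v, yet they are orthogonal.\<close>
    have "cinner (column i U) v *s v = of_real (d i) *s column i U"
      using diagonalises_eigenvector[OF D, of i] by (simp add: outer_mv)
    then have "cinner (cinner (column i U) v *s v) (column j U) = 0"
      using unitary_columns[OF U, of i j] ij(1) by simp
    then show False using ij(2,3) d[of i] d[of j] cnj_cinner[of v "column i U"] by auto
  qed
  then obtain i0 where i0: "\<And>i. i \<noteq> i0 \<Longrightarrow> d i = 0" by blast
  have nv: "(norm v)\<^sup>2 = (\<Sum>i\<in>UNIV. d i)"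
    using norm_expand_unitary[OF U, of v] by (simp add: d)
  also have "\<dots> = d i0" using i0 by (simp add: sum.remove[of UNIV i0])
  finally have n: "(norm v)\<^sup>2 = d i0" .
  then have dd: "d = (\<lambda>i. if i = i0 then (norm v)\<^sup>2 else 0)" using i0 by auto
  have "qf A v = (norm v)\<^sup>2 * qf A (column i0 U)" for A
  proof -
    have "cinner (column i0 U) v *s v = of_real (d i0) *s column i0 U"
      using diagonalises_eigenvector[OF D, of i0] by (simp add: outer_mv)
    then have "qf A (cinner (column i0 U) v *s v) = qf A (of_real (d i0) *s column i0 U)" by simp
    then have "d i0 * qf A v = d i0 * (d i0 * qf A (column i0 U))"
      by (simp only: qf_scale_vec norm_of_real power2_abs)
        (simp add: d[of i0] cmod_cinner_commute[of "column i0 U"] power2_eq_square mult.assoc)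
    then show ?thesis using n by (cases "v = 0") auto
  qed
  then show ?thesis using D dd that by blast
qed

lemma trf_outer_plus_scalar:
  fixes v :: "complex ^ 'n"
  shows "trf g (a *\<^sub>R outer v + b *\<^sub>R mat 1) = g (a * (norm v)\<^sup>2 + b) + (real CARD('n) - 1) * g b"
proof -
  obtain U i0 where D: "diagonalises U (\<lambda>i. if i = i0 then (norm v)\<^sup>2 else 0) (outer v)"
    using outer_diagonalises by blast
  have "trf g (a *\<^sub>R outer v + b *\<^sub>R mat 1)
      = (\<Sum>i\<in>UNIV. if i = i0 then g (a * (norm v)\<^sup>2 + b) else g b)"
    by (subst trf_eq[OF diagonalises_affine[OF D]]) (rule sum.cong, auto)
  also have "\<dots> = g (a * (norm v)\<^sup>2 + b) + (\<Sum>i\<in>UNIV - {i0}. g b)"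
    by (subst sum.remove[of _ i0]) (auto intro: sum.cong)
  also have "\<dots> = g (a * (norm v)\<^sup>2 + b) + (real CARD('n) - 1) * g b"
    by (simp add: of_nat_diff Suc_leI)
  finally show ?thesis .
qed

lemma trf_cong:
  fixes A :: "complex ^ 'n ^ 'n"
  assumes "psd A" "\<And>x. 0 \<le> x \<Longrightarrow> g x = h x"
  shows "trf g A = trf h A"
proof -
  obtain U d where A: "diagonalises U d A"
    using assms(1) psd_hermitian hermitian_diagonalises by blast
  show ?thesis
    using assms diagonalises_psd[OF A] by (simp add: trf_eq[OF A])
qed

lemma trf_add:
  assumes "psd A"
  shows "trf (\<lambda>x. g x + h x) A = trf g A + trf h A"
proof -
  obtain U d where A: "diagonalises U d A"
    using assms psd_hermitian hermitian_diagonalises by blast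
  show ?thesis by (simp add: trf_eq[OF A] sum.distrib)
qed

lemma trf_bound:
  fixes A :: "complex ^ 'n ^ 'n"
  assumes "psd A" "\<And>x. 0 \<le> x \<Longrightarrow> \<bar>g x\<bar> \<le> K"
  shows "\<bar>trf g A\<bar> \<le> real CARD('n) * K"
proof -
  obtain U d where A: "diagonalises U d A"
    using assms(1) psd_hermitian hermitian_diagonalises by blast
  have "\<bar>trf g A\<bar> \<le> (\<Sum>i\<in>UNIV. \<bar>g (d i)\<bar>)"
    by (simp add: trf_eq[OF A] sum_abs)
  also have "\<dots> \<le> (\<Sum>i\<in>(UNIV :: 'n set). K)"
    using assms diagonalises_psd[OF A] by (intro sum_mono) auto
  finally show ?thesis by simp
qed

text \<open>Convergence from above in the order. Along such a sequence monotone trace functions can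
  be squeezed, which replaces continuity of the functional calculus.\<close>

definition lim_above :: "(nat \<Rightarrow> complex ^ 'n ^ 'n) \<Rightarrow> complex ^ 'n ^ 'n \<Rightarrow> bool" where
  "lim_above Y X \<longleftrightarrow> (\<forall>k. X \<preceq> Y k) \<and>
     (\<forall>e>0. \<forall>\<^sub>F k in sequentially. Y k \<preceq> X + e *\<^sub>R mat 1)"

lemma lim_above_combination:
  assumes "lim_above X A" "lim_above Y B" "0 < a" "0 < b"
  shows "lim_above (\<lambda>k. a *\<^sub>R X k + b *\<^sub>R Y k) (a *\<^sub>R A + b *\<^sub>R B)"
proof -
  have comb: "a *\<^sub>R C + b *\<^sub>R D \<preceq> a *\<^sub>R C' + b *\<^sub>R D'" if "C \<preceq> C'" "D \<preceq> D'" for C C' D D' :: "complex ^ 'a ^ 'a"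
    using psd_add[OF psd_scaleR[of "C' - C" a] psd_scaleR[of "D' - D" b]] that assms(3,4)
    by (simp add: loewner_def algebra_simps)
  have "\<forall>\<^sub>F k in sequentially. a *\<^sub>R X k + b *\<^sub>R Y k \<preceq> a *\<^sub>R A + b *\<^sub>R B + e *\<^sub>R mat 1"
    if e: "0 < e" for e
  proof -
    have "\<forall>\<^sub>F k in sequentially. X k \<preceq> A + (e / (2 * a)) *\<^sub>R mat 1"
         "\<forall>\<^sub>F k in sequentially. Y k \<preceq> B + (e / (2 * b)) *\<^sub>R mat 1"
      using assms e by (simp_all add: lim_above_def)
    then show ?thesis
    proof eventually_elim
      case (elim k)
      from comb[OF this] assms(3,4) show ?case
        by (simp add: algebra_simps flip: scaleR_add_left)
    qed
  qed
  then show ?thesis using assms comb by (simp add: lim_above_def)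
qed

text \<open>\<open>trf g (Y k)\<close> eventually lies between the values at X and at X + e, and the
  latter is explicit because adding e shifts every eigenvalue.\<close>

lemma trf_lim_above:
  assumes lim: "lim_above Y X" and X: "psd X"
    and conv: "convex_on {0..} g" and cont: "continuous_on {0..} g"
    and mono: "mono_on {0..} g \<or> antimono_on {0..} g"
  shows "(\<lambda>k. trf g (Y k)) \<longlonglongrightarrow> trf g X"
proof -
  obtain U d where D: "diagonalises U d X"
    using X psd_hermitian hermitian_diagonalises by blast
  have d: "0 \<le> d i" for i using diagonalises_psd[OF D] X by simp
  have shift: "trf g (X + e *\<^sub>R mat 1) = (\<Sum>i\<in>UNIV. g (d i + e))" for e
    using trf_eq[OF diagonalises_affine[OF D, of 1 e]] by simp
  have "continuous_on {0..} (\<lambda>e. \<Sum>i\<in>UNIV. g (d i + e))"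
    by (intro continuous_intros continuous_on_compose2[OF cont]) (auto simp: d)
  then have "((\<lambda>e. \<Sum>i\<in>UNIV. g (d i + e)) \<longlongrightarrow> (\<Sum>i\<in>UNIV. g (d i + 0))) (at 0 within {0..})"
    unfolding continuous_on_def by (drule_tac bspec[where x = 0]) simp_all
  then have lim0: "((\<lambda>e. trf g (X + e *\<^sub>R mat 1)) \<longlongrightarrow> trf g X) (at 0 within {0..})"
    by (simp add: shift trf_eq[OF D])
  show ?thesis
  proof (rule tendstoI)
    fix r :: real assume "0 < r"
    with lim0 have "\<forall>\<^sub>F e in at 0 within {0..}. dist (trf g (X + e *\<^sub>R mat 1)) (trf g X) < r"
      by (rule tendstoD)
    then obtain s where s: "0 < s" and
      s': "\<And>e. 0 \<le> e \<Longrightarrow> e \<noteq> 0 \<Longrightarrow> e < s \<Longrightarrow> dist (trf g (X + e *\<^sub>R mat 1)) (trf g X) < r"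
      by (auto simp: eventually_at dist_real_def)
    define e where "e = s / 2"
    have e: "0 < e" "dist (trf g (X + e *\<^sub>R mat 1)) (trf g X) < r"
      using s s'[of "s / 2"] by (simp_all add: e_def)
    have "\<forall>\<^sub>F k in sequentially. Y k \<preceq> X + e *\<^sub>R mat 1"
      using lim e(1) by (simp add: lim_above_def)
    then show "\<forall>\<^sub>F k in sequentially. dist (trf g (Y k)) (trf g X) < r"
    proof eventually_elim
      case (elim k)
      have XY: "X \<preceq> Y k" using lim by (simp add: lim_above_def)
      have Y: "psd (Y k)" using X XY by (rule psd_loewner)
      from mono show ?case
      proof
        assume m: "mono_on {0..} g"
        show ?thesis
          using trf_mono[OF conv m X XY] trf_mono[OF conv m Y elim] e(2) by (simp add: dist_real_def)
      next
        assume m: "antimono_on {0..} g"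
        show ?thesis
          using trf_antimono[OF conv m X XY] trf_antimono[OF conv m Y elim] e(2)
          by (simp add: dist_real_def)
      qed
    qed
  qed
qed

text \<open>F is cut at a minimiser m: \<open>F (max x m)\<close> keeps the increasing branch and
  \<open>F (min x m) - F m\<close> the decreasing one, which is bounded by \<open>F 0 - F m\<close>.
  Both are convex because F is monotone on either side of m.\<close>

lemma convex_monotone_decomposition:
  fixes F :: "real \<Rightarrow> real"
  assumes conv: "convex_on {0..} F" and cont: "continuous_on {0..} F"
    and p: "0 \<le> p" "p < q" "F p < F q"
  obtains h k K where "convex_on {0..} h" "mono_on {0..} h" "continuous_on {0..} h"
    "convex_on {0..} k" "antimono_on {0..} k" "continuous_on {0..} k"
    "\<And>x. 0 \<le> x \<Longrightarrow> F x = h x + k x" "\<And>x. 0 \<le> x \<Longrightarrow> \<bar>k x\<bar> \<le> K"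
proof -
  have between: "F y \<le> max (F x) (F z)" if "0 \<le> x" "x \<le> y" "y \<le> z" for x y z
    by (rule convex_on_le_max[OF convex_on_subset[OF conv]]) (use that in auto)
  have "compact {0..q}" "{0..q} \<noteq> {}" "continuous_on {0..q} F"
    using p by (auto intro: continuous_on_subset[OF cont])
  then obtain m where m: "0 \<le> m" "m \<le> q" and min: "\<And>y. 0 \<le> y \<Longrightarrow> y \<le> q \<Longrightarrow> F m \<le> F y"
    using continuous_attains_inf[of "{0..q}" F] by auto
  \<comment> \<open>Past q, convexity and F p < F q keep F at or above F q, so the minimum over
    [0, q] is global.\<close>
  have Fm: "F m \<le> F y" if "0 \<le> y" for y
  proof (cases "y \<le> q")
    case False
    then show ?thesis using between[of p q y] p min[of q] by auto
  qed (use min that in auto)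
  have up: "F x \<le> F y" if "m \<le> x" "x \<le> y" for x y
    using between[of m x y] that m Fm[of y] by (simp add: max_def split: if_splits)
  have down: "F y \<le> F x" if "0 \<le> x" "x \<le> y" "y \<le> m" for x y
    using between[of x y m] that m Fm[of x] by (simp add: max_def split: if_splits)
  show ?thesis
  proof
    show "convex_on {0..} (\<lambda>x. F (max x m))"
    proof (rule convex_onI)
      fix t x y :: real assume *: "0 < t" "t < 1" "x \<in> {0..}" "y \<in> {0..}"
      have "F (max ((1 - t) *\<^sub>R x + t *\<^sub>R y) m) \<le> F ((1 - t) *\<^sub>R max x m + t *\<^sub>R max y m)"
      proof (rule up)
        have "(1 - t) * m + t * m \<le> (1 - t) * max x m + t * max y m"
          using * by (intro add_mono mult_left_mono) auto
        moreover have "(1 - t) * x + t * y \<le> (1 - t) * max x m + t * max y m"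
          using * by (intro add_mono mult_left_mono) auto
        ultimately show "max ((1 - t) *\<^sub>R x + t *\<^sub>R y) m \<le> (1 - t) *\<^sub>R max x m + t *\<^sub>R max y m"
          by (simp only: max.bounded_iff real_scaleR_def) (simp add: algebra_simps)
      qed simp
      also have "\<dots> \<le> (1 - t) * F (max x m) + t * F (max y m)"
        using * by (intro convex_onD[OF conv]) auto
      finally show "F (max ((1 - t) *\<^sub>R x + t *\<^sub>R y) m) \<le> (1 - t) * F (max x m) + t * F (max y m)" .
    qed simp
    show "convex_on {0..} (\<lambda>x. F (min x m) - F m)"
    proof (rule convex_onI)
      fix t x y :: real assume *: "0 < t" "t < 1" "x \<in> {0..}" "y \<in> {0..}"
      have "F (min ((1 - t) *\<^sub>R x + t *\<^sub>R y) m) \<le> F ((1 - t) *\<^sub>R min x m + t *\<^sub>R min y m)"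
      proof (rule down)
        have "(1 - t) * min x m + t * min y m \<le> (1 - t) * m + t * m"
          using * by (intro add_mono mult_left_mono) auto
        moreover have "(1 - t) * min x m + t * min y m \<le> (1 - t) * x + t * y"
          using * by (intro add_mono mult_left_mono) auto
        ultimately show "(1 - t) *\<^sub>R min x m + t *\<^sub>R min y m \<le> min ((1 - t) *\<^sub>R x + t *\<^sub>R y) m"
          by (simp only: min.bounded_iff real_scaleR_def) (simp add: algebra_simps)
      qed (use * m in auto)
      also have "\<dots> \<le> (1 - t) * F (min x m) + t * F (min y m)"
        using * m by (intro convex_onD[OF conv]) auto
      finally show "F (min ((1 - t) *\<^sub>R x + t *\<^sub>R y) m) - F m
          \<le> (1 - t) * (F (min x m) - F m) + t * (F (min y m) - F m)"
        by (simp add: algebra_simps)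
    qed simp
    show "mono_on {0..} (\<lambda>x. F (max x m))"
      by (intro mono_onI up) auto
    show "antimono_on {0..} (\<lambda>x. F (min x m) - F m)"
      using m by (intro monotone_onI) (auto intro!: down)
    show "continuous_on {0..} (\<lambda>x. F (max x m))"
      using m by (intro continuous_on_compose2[OF cont] continuous_intros) auto
    show "continuous_on {0..} (\<lambda>x. F (min x m) - F m)"
      using m by (intro continuous_intros continuous_on_compose2[OF cont]) auto
    show "F x = F (max x m) + (F (min x m) - F m)" if "0 \<le> x" for x
      by (simp add: max_def min_def)
    show "\<bar>F (min x m) - F m\<bar> \<le> F 0 - F m" if "0 \<le> x" for x
      using that m Fm[of "min x m"] down[of 0 "min x m"] by auto
  qed
qed

section \<open>The Jensen divergence determines the Loewner order\<close>

text \<open>The hypotheses on f in working form: F is f extended to 0 by its limit, so that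
  convexity and continuity hold on the closed half-line, and strict convexity is recorded as strict
  growth of the derivative.\<close>

locale jensen_function =
  fixes F F' :: "real \<Rightarrow> real" and l :: real
  assumes F_convex: "convex_on {0..} F"
    and F_continuous: "continuous_on {0..} F"
    and F_deriv: "\<And>x. 0 < x \<Longrightarrow> (F has_real_derivative F' x) (at x)"
    and F'_strict_mono: "\<And>x y. 0 < x \<Longrightarrow> x < y \<Longrightarrow> F' x < F' y"
    and F'_unbounded: "\<And>b. \<exists>x>0. b < F' x"
    and l: "0 < l" "l < 1"
begin

lemma tangent_le:
  assumes "0 < x" "0 \<le> y"
  shows "F' x * (y - x) \<le> F y - F x"
proof (rule convex_on_imp_above_tangent[OF F_convex])
  show "x \<in> interior {0..}" using assms by simp
  show "(F has_real_derivative F' x) (at x within {0..})"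
    using F_deriv[OF assms(1)] by (rule has_field_derivative_at_within)
qed (use assms in auto)

lemma decomposition:
  obtains h k K where "convex_on {0..} h" "mono_on {0..} h" "continuous_on {0..} h"
    "convex_on {0..} k" "antimono_on {0..} k" "continuous_on {0..} k"
    "\<And>x. 0 \<le> x \<Longrightarrow> F x = h x + k x" "\<And>x. 0 \<le> x \<Longrightarrow> \<bar>k x\<bar> \<le> K"
proof -
  obtain p where p: "0 < p" "0 < F' p" using F'_unbounded by blast
  then have "F p < F (p + 1)" using tangent_le[of p "p + 1"] by simp
  then show ?thesis
    using convex_monotone_decomposition[OF F_convex F_continuous, of p "p + 1"] p(1) that by auto
qed

definition J :: "complex ^ 'n ^ 'n \<Rightarrow> complex ^ 'n ^ 'n \<Rightarrow> real" where
  "J X Y = l * trf F X + (1 - l) * trf F Y - trf F (l *\<^sub>R X + (1 - l) *\<^sub>R Y)"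

lemma trf_F_lim_above:
  assumes "lim_above Y X" "psd X"
  shows "(\<lambda>k. trf F (Y k)) \<longlonglongrightarrow> trf F X"
proof -
  obtain h k K where hk: "convex_on {0..} h" "mono_on {0..} h" "continuous_on {0..} h"
    "convex_on {0..} k" "antimono_on {0..} k" "continuous_on {0..} k"
    "\<And>x. 0 \<le> x \<Longrightarrow> F x = h x + k x" "\<And>x. 0 \<le> x \<Longrightarrow> \<bar>k x\<bar> \<le> K"
    using decomposition by metis
  have split: "trf F A = trf h A + trf k A" if "psd A" for A :: "complex ^ 'a ^ 'a"
    using trf_cong[OF that, of F "\<lambda>x. h x + k x"] trf_add[OF that, of h k] hk(7) by simp
  have Y: "psd (Y j)" for j
    using assms by (auto simp: lim_above_def intro: psd_loewner)
  have "(\<lambda>j. trf h (Y j) + trf k (Y j)) \<longlonglongrightarrow> trf h X + trf k X"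
    using hk assms by (intro tendsto_add trf_lim_above) auto
  then show ?thesis by (simp add: split Y assms(2))
qed

lemma J_lim_above:
  assumes "lim_above X A" "lim_above Y B" "psd A" "psd B"
  shows "(\<lambda>k. J (X k) (Y k)) \<longlonglongrightarrow> J A B"
  unfolding J_def using assms l
  by (intro tendsto_intros trf_F_lim_above lim_above_combination psd_add psd_scaleR) auto

lemma positive_definite_mix:
  "positive_definite X \<Longrightarrow> positive_definite Y \<Longrightarrow> positive_definite (l *\<^sub>R X + (1 - l) *\<^sub>R Y)"
  using l by (intro positive_definite_add_psd positive_definite_scaleR positive_definite_imp_psd) auto

text \<open>The terms in X alone cancel in \<open>J X A - J X B\<close>, which leaves a constant
  plus \<open>trf F (M B) - trf F (M A)\<close>. The increasing part of F contributes with the right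
  sign, and the decreasing part is bounded at both matrices.\<close>

lemma J_diff_bounded_below:
  fixes A B :: "complex ^ 'n ^ 'n"
  assumes A: "positive_definite A" and AB: "A \<preceq> B"
  shows "\<exists>c. \<forall>X. positive_definite X \<longrightarrow> c \<le> J X A - J X B"
proof -
  obtain h k K where hk: "convex_on {0..} h" "mono_on {0..} h" "continuous_on {0..} h"
    "convex_on {0..} k" "antimono_on {0..} k" "continuous_on {0..} k"
    "\<And>x. 0 \<le> x \<Longrightarrow> F x = h x + k x" "\<And>x. 0 \<le> x \<Longrightarrow> \<bar>k x\<bar> \<le> K"
    using decomposition by metis
  define c where "c = (1 - l) * (trf F A - trf F B) - 2 * (real CARD('n) * K)"
  have "c \<le> J X A - J X B" if X: "positive_definite X" for X
  proof -
    define M where "M C = l *\<^sub>R X + (1 - l) *\<^sub>R C" for C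
    have M: "psd (M A)" "psd (M B)"
      unfolding M_def using X A positive_definite_loewner[OF A AB]
      by (auto intro: positive_definite_imp_psd positive_definite_mix)
    have "M B - M A = (1 - l) *\<^sub>R (B - A)" by (simp add: M_def algebra_simps)
    then have "M A \<preceq> M B" using AB l by (simp add: loewner_def psd_scaleR)
    then have "trf h (M A) \<le> trf h (M B)" using trf_mono hk M by blast
    moreover have "\<bar>trf k (M C)\<bar> \<le> real CARD('n) * K" if "psd (M C)" for C
      using trf_bound[OF that hk(8)] .
    moreover have "trf F (M C) = trf h (M C) + trf k (M C)" if "psd (M C)" for C
      using trf_cong[OF that, of F "\<lambda>x. h x + k x"] trf_add[OF that, of h k] hk(7) by simp
    ultimately have "trf F (M A) - 2 * (real CARD('n) * K) \<le> trf F (M B)"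
      using M by (smt (verit))
    moreover have "J X A - J X B = (1 - l) * (trf F A - trf F B) + trf F (M B) - trf F (M A)"
      unfolding J_def M_def[symmetric] by (simp add: algebra_simps)
    ultimately show ?thesis unfolding c_def by linarith
  qed
  then show ?thesis by blast
qed

end

section \<open>Detecting the order with large rank one matrices\<close>

lemma qf_le_norm:
  fixes C :: "complex ^ 'n ^ 'n"
  obtains c where "0 \<le> c" "\<And>x. qf C x \<le> c * (norm x)\<^sup>2"
proof -
  have "linear ((*v) C)"
    by (rule linearI) (simp_all add: matrix_vector_right_distrib scaleR_vec_of_real vector_scalar_commute)
  then obtain c where c: "0 < c" "\<And>x. norm (C *v x) \<le> c * norm x"
    using linear_bounded_pos by blast
  have "qf C x \<le> c * (norm x)\<^sup>2" for x
  proof -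
    have "qf C x \<le> norm (C *v x) * norm x"
      unfolding qf_def Re_cinner by (rule norm_cauchy_schwarz)
    also have "\<dots> \<le> c * norm x * norm x" using c(2) by (intro mult_right_mono) auto
    finally show ?thesis by (simp add: power2_eq_square mult.assoc)
  qed
  then show ?thesis using c(1) that by (metis less_imp_le)
qed

text \<open>Relative to the line of v and its complement, the off-diagonal block of C is absorbed by
  enlarging the corner by \<delta> and taking K large. The point is that the bound has explicit
  eigenvalues.\<close>

lemma hermitian_le_outer_plus_complement:
  fixes C :: "complex ^ 'n ^ 'n"
  assumes C: "ctranspose C = C" and v: "norm v = 1" and \<delta>: "0 < \<delta>"
  shows "\<exists>K\<ge>0. C \<preceq> (qf C v + \<delta>) *\<^sub>R outer v + K *\<^sub>R (mat 1 - outer v)"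
proof -
  obtain c where c: "0 \<le> c" "\<And>x. qf C x \<le> c * (norm x)\<^sup>2" using qf_le_norm by metis
  define N where "N = norm (C *v v)"
  \<comment> \<open>c bounds C on the complement of v, and \<open>N\<^sup>2 / \<delta>\<close> is
    the price of splitting the cross term by the weighted arithmetic-geometric mean
    inequality.\<close>
  define K where "K = c + N\<^sup>2 / \<delta>"
  have K: "0 \<le> K" using c \<delta> by (simp add: K_def)
  have "qf C x \<le> qf ((qf C v + \<delta>) *\<^sub>R outer v + K *\<^sub>R (mat 1 - outer v)) x" for x
  proof -
    define \<alpha> where "\<alpha> = cinner x v"
    define y where "y = x - \<alpha> *s v"
    have x: "x = \<alpha> *s v + y" by (simp add: y_def)
    have vv: "cinner v v = 1" using v by (simp add: cinner_self)
    have yv: "cinner y v = 0" by (simp add: y_def cinner_diff_left vv \<alpha>_def)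
    then have vy: "cinner v y = 0" by (metis cnj_cinner complex_cnj_zero)
    have nx: "(norm x)\<^sup>2 = (cmod \<alpha>)\<^sup>2 + (norm y)\<^sup>2"
      using qf_add_vec[of "mat 1" "\<alpha> *s v" y] qf_scale_vec[of "mat 1" \<alpha> v]
      by (simp add: x[symmetric] vy v)
    have "Re (cinner (C *v (\<alpha> *s v)) y) \<le> cmod \<alpha> * (N * norm y)"
      using complex_Re_le_cmod[of "\<alpha> * cinner (C *v v) y"] cmod_cinner_le[of "C *v v" y]
        mult_left_mono[of "cmod (cinner (C *v v) y)" "N * norm y" "cmod \<alpha>"]
      by (simp add: vector_scalar_commute norm_mult N_def)
    moreover have "2 * (cmod \<alpha> * (N * norm y)) \<le> \<delta> * (cmod \<alpha>)\<^sup>2 + N\<^sup>2 / \<delta> * (norm y)\<^sup>2"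
    proof -
      have "0 \<le> (\<delta> * cmod \<alpha> - N * norm y)\<^sup>2 / \<delta>" using \<delta> by simp
      also have "\<dots> = \<delta> * (cmod \<alpha>)\<^sup>2 + N\<^sup>2 / \<delta> * (norm y)\<^sup>2 - 2 * (cmod \<alpha> * (N * norm y))"
        using \<delta> by (simp add: field_simps power2_eq_square)
      finally show ?thesis by simp
    qed
    ultimately have "qf C x \<le> (cmod \<alpha>)\<^sup>2 * qf C v + (\<delta> * (cmod \<alpha>)\<^sup>2 + N\<^sup>2 / \<delta> * (norm y)\<^sup>2)
        + c * (norm y)\<^sup>2"
      using qf_add_vec[OF C, of "\<alpha> *s v" y] c(2)[of y] by (simp add: x[symmetric] qf_scale_vec)
    then show ?thesis
      by (simp add: qf_simps nx K_def algebra_simps flip: \<alpha>_def)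
  qed
  then have "C \<preceq> (qf C v + \<delta>) *\<^sub>R outer v + K *\<^sub>R (mat 1 - outer v)"
    using C by (subst loewner_iff) (simp_all add: ctranspose_simps)
  then show ?thesis using K by blast
qed

context jensen_function
begin

text \<open>Peierls' inequality in an orthonormal basis that contains v up to a phase; the other n -
  1 diagonal values contribute at least m each.\<close>

lemma trf_F_rank_one_lower:
  fixes A :: "complex ^ 'n ^ 'n"
  assumes "psd A" "norm v = 1" and m: "\<And>x. 0 \<le> x \<Longrightarrow> m \<le> F x"
  shows "F (qf A v) + (real CARD('n) - 1) * m \<le> trf F A"
proof -
  obtain U i0 where D: "diagonalises U (\<lambda>i. if i = i0 then (norm v)\<^sup>2 else 0) (outer v)"
    and q: "\<And>A. qf A v = (norm v)\<^sup>2 * qf A (column i0 U)"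
    using outer_diagonalises by metis
  have "F (qf A v) + (real CARD('n) - 1) * m = F (qf A (column i0 U)) + (\<Sum>i\<in>UNIV - {i0}. m)"
    using assms(2) q[of A] by (simp add: of_nat_diff Suc_leI)
  also have "\<dots> \<le> F (qf A (column i0 U)) + (\<Sum>i\<in>UNIV - {i0}. F (qf A (column i U)))"
    using assms(1) by (intro add_left_mono sum_mono m psd_qf)
  also have "\<dots> = (\<Sum>i\<in>UNIV. F (qf A (column i U)))"
    by (subst (2) sum.remove[of _ i0]) auto
  also have "\<dots> \<le> trf F A"
    using D assms(1) F_convex by (intro peierls_psd) (simp_all add: diagonalises_def)
  finally show ?thesis .
qed

text \<open>In a direction v where A exceeds B, the trace for A is at least
  \<open>F (z + \<delta>)\<close> and that for B at most \<open>F z\<close>, up to constants. Since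
  \<open>F (z + \<delta>) - F z\<close> is at least \<open>\<delta> * F' z\<close>, a lower bound
  for the difference of divergences would bound F' from above.\<close>

lemma J_diff_bounded_below_imp_loewner:
  fixes A B :: "complex ^ 'n ^ 'n"
  assumes A: "positive_definite A" and B: "positive_definite B"
    and bdd: "\<And>X. positive_definite X \<Longrightarrow> c \<le> J X A - J X B"
  shows "A \<preceq> B"
proof (rule ccontr)
  assume "\<not> A \<preceq> B"
  then obtain x where x: "qf B x < qf A x"
    using A B by (auto simp: loewner_iff positive_definite_iff not_le)
  then have x0: "x \<noteq> 0" by auto
  define v where "v = (1 / norm x) *\<^sub>R x"
  have v: "norm v = 1" using x0 by (simp add: v_def)
  have vAB: "qf B v < qf A v" using x x0 unfolding v_def qf_scaleR_vec by simp
  obtain h k K' where hk: "convex_on {0..} h" "mono_on {0..} h" "continuous_on {0..} h"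
    "convex_on {0..} k" "antimono_on {0..} k" "continuous_on {0..} k"
    "\<And>x. 0 \<le> x \<Longrightarrow> F x = h x + k x" "\<And>x. 0 \<le> x \<Longrightarrow> \<bar>k x\<bar> \<le> K'"
    using decomposition by metis
  \<comment> \<open>F is bounded below, since h is least at 0 and k is at least - K'.\<close>
  have m: "h 0 - K' \<le> F y" if "0 \<le> y" for y
    using hk(7,8)[OF that] mono_onD[OF hk(2), of 0 y] that by auto
  define C where "C D = l *\<^sub>R mat 1 + (1 - l) *\<^sub>R D" for D :: "complex ^ 'n ^ 'n"
  have C_pd: "positive_definite (C A)" "positive_definite (C B)"
    using A B by (simp_all add: C_def positive_definite_mix)
  \<comment> \<open>Half of the gap along v: one half pays for the off-diagonal block of C B, the
    other remains as the distance between the values b and b + \<delta>.\<close>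
  define \<delta> where "\<delta> = (qf (C A) v - qf (C B) v) / 2"
  have "qf (C A) v - qf (C B) v = (1 - l) * (qf A v - qf B v)"
    by (simp add: C_def qf_simps algebra_simps)
  then have \<delta>: "0 < \<delta>" using vAB l by (simp add: \<delta>_def)
  define b where "b = qf (C B) v + \<delta>"
  have b: "0 \<le> b" "qf (C A) v = b + \<delta>"
    using \<delta> psd_qf[OF positive_definite_imp_psd[OF C_pd(2)], of v] by (auto simp: b_def \<delta>_def field_simps)
  obtain K where K: "0 \<le> K" "C B \<preceq> b *\<^sub>R outer v + K *\<^sub>R (mat 1 - outer v)"
    using hermitian_le_outer_plus_complement[OF _ v \<delta>, of "C B"] C_pd(2)
    by (auto simp: b_def positive_definite_iff)
  define n where "n = real CARD('n)"
  define p where "p = (n - 1) * (h 0 - K')"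
  \<comment> \<open>K' comes from h z \<le> F z + K', the h K terms from the n - 1 eigenvalues off
    v, and n K' from the decreasing part.\<close>
  define q where "q = K' + (n - 1) * h K + n * K'"
  define s where "s = (1 - l) * (trf F A - trf F B)"
  define r where "r = s + q - p"
  have bound: "\<delta> * F' z \<le> r - c" if z: "b < z" for z
  proof -
    \<comment> \<open>Chosen so that l t + b = z, the eigenvalue along v of the upper bound for M
      B.\<close>
    define t where "t = (z - b) / l"
    have t: "0 < t" "l * t = z - b" using z l by (simp_all add: t_def)
    define X where "X = t *\<^sub>R outer v + mat 1"
    have X: "positive_definite X"
      using t positive_definite_add_psd[of "mat 1" "t *\<^sub>R outer v"]
      by (simp add: X_def psd_scaleR add.commute)
    define M where "M D = l *\<^sub>R X + (1 - l) *\<^sub>R D" for D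
    have M: "M D = (z - b) *\<^sub>R outer v + C D" for D
      by (simp add: M_def X_def C_def algebra_simps flip: t(2))
    have M_psd: "psd (M A)" "psd (M B)"
      unfolding M_def using X A B by (auto intro: positive_definite_imp_psd positive_definite_mix)
    have z0: "0 < z" using z b by simp
    have "qf (M A) v = z + \<delta>"
      by (simp add: M qf_simps cinner_self v b)
    then have lower: "F (z + \<delta>) + p \<le> trf F (M A)"
      using trf_F_rank_one_lower[OF M_psd(1) v m] by (simp add: n_def p_def)
    have "M B \<preceq> (z - K) *\<^sub>R outer v + K *\<^sub>R mat 1"
      using K(2) by (simp add: M loewner_def algebra_simps)
    then have "trf h (M B) \<le> trf h ((z - K) *\<^sub>R outer v + K *\<^sub>R mat 1)"
      using M_psd hk by (intro trf_mono)
    also have "\<dots> = h z + (n - 1) * h K"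
      by (simp add: trf_outer_plus_scalar v n_def)
    finally have "trf h (M B) \<le> F z + K' + (n - 1) * h K"
      using hk(7,8)[of z] z0 by auto
    moreover have "trf F (M B) = trf h (M B) + trf k (M B)"
      using trf_cong[OF M_psd(2), of F "\<lambda>x. h x + k x"] trf_add[OF M_psd(2), of h k] hk(7) by simp
    moreover have "\<bar>trf k (M B)\<bar> \<le> n * K'"
      using trf_bound[OF M_psd(2) hk(8)] by (simp add: n_def)
    ultimately have upper: "trf F (M B) \<le> F z + q" by (simp add: q_def)
    have "c \<le> s + trf F (M B) - trf F (M A)"
    proof -
      have "J X A - J X B = s + trf F (M B) - trf F (M A)"
        unfolding J_def M_def[symmetric] s_def by (simp add: algebra_simps)
      then show ?thesis using bdd[OF X] by linarith
    qed
    moreover have "\<delta> * F' z \<le> F (z + \<delta>) - F z"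
      using tangent_le[of z "z + \<delta>"] z0 \<delta> by (simp add: mult.commute)
    ultimately show ?thesis using lower upper unfolding r_def by linarith
  qed
  obtain y where y: "0 < y" "(r - c) / \<delta> < F' y" using F'_unbounded by blast
  define z where "z = max y (b + 1)"
  have "y \<le> z" by (simp add: z_def)
  then have "F' y \<le> F' z" using F'_strict_mono[of y z] y(1) by (auto simp: le_less)
  moreover have "F' z \<le> (r - c) / \<delta>"
    using bound[of z] \<delta> by (simp add: z_def pos_le_divide_eq mult.commute)
  ultimately show False using y(2) by linarith
qed

lemma loewner_iff_J_bounded:
  assumes "positive_definite A" "positive_definite B"
  shows "A \<preceq> B \<longleftrightarrow> (\<exists>c. \<forall>X. positive_definite X \<longrightarrow> c \<le> J X A - J X B)"
  using J_diff_bounded_below J_diff_bounded_below_imp_loewner assms by metis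

text \<open>\<open>J (outer v) 0\<close> is, up to a constant, G at |v|^2 for G x = l F x - F (l x).
  The derivative l (F' x - F' (l x)) is positive, so G is strictly increasing.\<close>

lemma J_outer_zero_inject:
  fixes u w :: "complex ^ 'n"
  assumes "J (outer u) 0 = J (outer w) 0" "u \<noteq> 0" "w \<noteq> 0"
  shows "norm u = norm w"
proof -
  define G where "G x = l * F x - F (l * x)" for x
  have J: "J (outer v) 0 = G ((norm v)\<^sup>2) + (1 - l) * trf F (0 :: complex ^ 'n ^ 'n)
      + (l - 1) * ((real CARD('n) - 1) * F 0)" for v :: "complex ^ 'n"
  proof -
    have "trf F (outer v) = F ((norm v)\<^sup>2) + (real CARD('n) - 1) * F 0"
      "trf F (l *\<^sub>R outer v) = F (l * (norm v)\<^sup>2) + (real CARD('n) - 1) * F 0"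
      using trf_outer_plus_scalar[of F 1 v 0] trf_outer_plus_scalar[of F l v 0] by simp_all
    then show ?thesis unfolding J_def G_def by (simp add: left_diff_distrib right_diff_distrib distrib_left)
  qed
  have G_mono: "G x < G y" if "0 < x" "x < y" for x y
  proof (rule DERIV_pos_imp_increasing[OF that(2)])
    fix z assume "x \<le> z" "z \<le> y"
    then have z: "0 < z" using that by simp
    have "(G has_real_derivative l * F' z - F' (l * z) * l) (at z)"
      unfolding G_def[abs_def] using z l
      by (auto intro!: derivative_eq_intros F_deriv DERIV_chain2[of F])
    moreover have "F' (l * z) < F' z" using z l by (intro F'_strict_mono) auto
    ultimately show "\<exists>y. (G has_real_derivative y) (at z) \<and> 0 < y"
      using l by (intro exI[of _ "l * F' z - F' (l * z) * l"]) simp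
  qed
  have "G ((norm u)\<^sup>2) = G ((norm w)\<^sup>2)" using assms(1) by (simp add: J)
  then have "(norm u)\<^sup>2 = (norm w)\<^sup>2"
    using G_mono[of "(norm u)\<^sup>2" "(norm w)\<^sup>2"] G_mono[of "(norm w)\<^sup>2" "(norm u)\<^sup>2"] assms(2,3)
    by (cases "(norm u)\<^sup>2" "(norm w)\<^sup>2" rule: linorder_cases) auto
  then show ?thesis by (simp add: power2_eq_iff_nonneg)
qed

end

section \<open>Order automorphisms of the positive definite cone\<close>

text \<open>The order given by the interior of the cone, in general stronger than
  \<open>A \<preceq> B\<close> with A \<noteq> B. Strict upper bounds of a semidefinite matrix are
  positive definite, so they lie where \<phi> is controlled.\<close>

definition loewner_strict :: "complex ^ 'n ^ 'n \<Rightarrow> complex ^ 'n ^ 'n \<Rightarrow> bool" (infix "\<prec>\<prec>" 50) where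
  "A \<prec>\<prec> B \<longleftrightarrow> positive_definite (B - A)"

lemma loewner_strict_imp_le: "A \<prec>\<prec> B \<Longrightarrow> A \<preceq> B"
  by (simp add: loewner_strict_def loewner_def positive_definite_imp_psd)

lemma loewner_le_strict_trans: "A \<preceq> B \<Longrightarrow> B \<prec>\<prec> C \<Longrightarrow> A \<prec>\<prec> C"
  using positive_definite_add_psd[of "C - B" "B - A"] by (simp add: loewner_strict_def loewner_def)

lemma loewner_strict_le_trans: "A \<prec>\<prec> B \<Longrightarrow> B \<preceq> C \<Longrightarrow> A \<prec>\<prec> C"
  using positive_definite_add_psd[of "B - A" "C - B"] by (simp add: loewner_strict_def loewner_def)

lemma loewner_strict_add_scalar: "0 < e \<Longrightarrow> A \<prec>\<prec> A + e *\<^sub>R mat 1"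
  by (simp add: loewner_strict_def positive_definite_scaleR)

lemma positive_definite_ge_scalar:
  fixes D :: "complex ^ 'n ^ 'n"
  assumes "positive_definite D"
  obtains e where "0 < e" "e *\<^sub>R mat 1 \<preceq> D"
proof -
  have herm: "ctranspose D = D" using assms by (simp add: positive_definite_iff)
  obtain U d where D: "diagonalises U d D"
    using hermitian_diagonalises herm by blast
  have U: "unitary_matrix U" using D by (simp add: diagonalises_def)
  define e where "e = Min (range d)"
  have "0 < e" unfolding e_def
    using diagonalises_positive_definite[OF D assms] by (subst Min_gr_iff) auto
  have "e * (norm x)\<^sup>2 \<le> qf D x" for x
    unfolding diagonalises_qf[OF D] norm_expand_unitary[OF U] sum_distrib_left
    by (intro sum_mono mult_right_mono) (auto simp: e_def)
  then have "e *\<^sub>R mat 1 \<preceq> D"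
    by (subst loewner_iff) (simp_all add: herm ctranspose_scaleR qf_scaleR)
  then show ?thesis using \<open>0 < e\<close> that by blast
qed

lemma loewner_strict_gap:
  assumes "A \<prec>\<prec> B"
  obtains e where "0 < e" "A + e *\<^sub>R mat 1 \<preceq> B"
proof -
  obtain e where "0 < e" "e *\<^sub>R mat 1 \<preceq> B - A"
    using assms positive_definite_ge_scalar loewner_strict_def by blast
  then show ?thesis using that[of e] by (simp add: loewner_def algebra_simps)
qed

lemma loewner_archimedean:
  assumes "ctranspose A = A" "ctranspose B = B"
    and "\<And>k. A \<preceq> B + (1 / real (Suc k)) *\<^sub>R mat 1"
  shows "A \<preceq> B"
proof -
  have "qf A x \<le> qf B x" for x
  proof (rule LIMSEQ_le_const)
    have "(\<lambda>k. qf B x + 1 / real (Suc k) * (norm x)\<^sup>2) \<longlonglongrightarrow> qf B x + 0 * (norm x)\<^sup>2"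
      by (intro tendsto_intros LIMSEQ_Suc[OF lim_1_over_n])
    then show "(\<lambda>k. qf B x + 1 / real (Suc k) * (norm x)\<^sup>2) \<longlonglongrightarrow> qf B x" by simp
    show "\<exists>N. \<forall>k\<ge>N. qf A x \<le> qf B x + 1 / real (Suc k) * (norm x)\<^sup>2"
      using loewner_qf[OF assms(3), of x] unfolding qf_add qf_scaleR qf_mat1 by blast
  qed
  then show ?thesis using assms by (simp add: loewner_iff)
qed

text \<open>Only positive definite C occur on the right, so the order of the closed cone can be
  transported by a map of the open cone.\<close>

lemma psd_le_iff_strict_upper_bounds:
  assumes "psd A" "psd B"
  shows "A \<preceq> B \<longleftrightarrow> (\<forall>C. positive_definite C \<longrightarrow> B \<prec>\<prec> C \<longrightarrow> A \<prec>\<prec> C)"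
proof
  assume *: "\<forall>C. positive_definite C \<longrightarrow> B \<prec>\<prec> C \<longrightarrow> A \<prec>\<prec> C"
  have "A \<preceq> B + (1 / real (Suc k)) *\<^sub>R mat 1" for k
  proof -
    have "positive_definite (B + (1 / real (Suc k)) *\<^sub>R mat 1)"
      using assms(2) by (rule psd_plus_scalar) simp
    moreover have "B \<prec>\<prec> B + (1 / real (Suc k)) *\<^sub>R mat 1"
      by (rule loewner_strict_add_scalar) simp
    ultimately show ?thesis using * by (blast intro: loewner_strict_imp_le)
  qed
  then show "A \<preceq> B" by (rule loewner_archimedean[OF psd_hermitian psd_hermitian, OF assms])
qed (metis loewner_le_strict_trans)

text \<open>A crude bound, enough to turn entrywise convergence into an inequality with a multiple
  of the identity.\<close>

lemma qf_le_entries: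
  fixes D :: "complex ^ 'n ^ 'n"
  shows "qf D x \<le> (\<Sum>i\<in>UNIV. \<Sum>j\<in>UNIV. cmod (D $ i $ j)) * (norm x)\<^sup>2"
proof -
  have "qf D x \<le> cmod (cinner (D *v x) x)" unfolding qf_def by (rule complex_Re_le_cmod)
  also have "cinner (D *v x) x = (\<Sum>i\<in>UNIV. \<Sum>j\<in>UNIV. D $ i $ j * x $ j * cnj (x $ i))"
    by (simp add: cinner_def matrix_vector_mult_def sum_distrib_right)
  also have "cmod \<dots> \<le> (\<Sum>i\<in>UNIV. \<Sum>j\<in>UNIV. cmod (D $ i $ j) * (norm x)\<^sup>2)"
  proof (intro sum_norm_le)
    fix i j
    have "cmod (x $ j) * cmod (x $ i) \<le> norm x * norm x"
      by (intro mult_mono) (auto simp: Finite_Cartesian_Product.norm_nth_le)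
    then show "cmod (D $ i $ j * x $ j * cnj (x $ i)) \<le> cmod (D $ i $ j) * (norm x)\<^sup>2"
      by (simp add: norm_mult power2_eq_square mult.assoc mult_left_mono)
  qed
  finally show ?thesis by (simp add: sum_distrib_right)
qed

text \<open>The quadratic forms decrease and are nonnegative, hence converge; polarisation turns
  this into convergence of the entries.\<close>

lemma decreasing_psd_converges:
  fixes X :: "nat \<Rightarrow> complex ^ 'n ^ 'n"
  assumes psd: "\<And>k. psd (X k)" and dec: "\<And>k m. k \<le> m \<Longrightarrow> X m \<preceq> X k"
  obtains L where "psd L" "lim_above X L"
proof -
  have herm: "ctranspose (X k) = X k" for k using psd psd_hermitian by blast
  have dec_qf: "decseq (\<lambda>k. qf (X k) x)" for x
    using dec by (simp add: decseq_def loewner_qf)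
  have conv_qf: "convergent (\<lambda>k. qf (X k) x)" for x
  proof -
    obtain r where "(\<lambda>k. qf (X k) x) \<longlonglongrightarrow> r"
      by (rule decseq_convergent[OF dec_qf[of x], of 0]) (use psd psd_qf in blast)
    then show ?thesis by (auto simp: convergent_def)
  qed
  have conv_Re: "convergent (\<lambda>k. Re (cinner (X k *v x) y))" for x y
  proof -
    have eq: "Re (cinner (X k *v x) y) = (qf (X k) (x + y) - qf (X k) x - qf (X k) y) * (1 / 2)" for k
      by (simp add: qf_add_vec[OF herm])
    show ?thesis
      unfolding eq by (intro convergent_mult convergent_diff conv_qf convergent_const)
  qed
  have "convergent (\<lambda>k. X k $ i $ j)" for i j
  proof -
    have eq: "X k $ i $ j = of_real (Re (cinner (X k *v axis j 1) (axis i 1)))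
        + \<i> * of_real (Re (cinner (X k *v axis j 1) (\<i> *s axis i 1)))" for k
      by (simp add: cinner_mv_axis complex_eq_iff)
    show ?thesis
      unfolding eq by (intro convergent_add convergent_mult convergent_const convergent_of_real conv_Re)
  qed
  then have lim: "(\<lambda>k. X k $ i $ j) \<longlonglongrightarrow> lim (\<lambda>k. X k $ i $ j)" for i j
    by (simp add: convergent_LIMSEQ_iff)
  define L where "L = (\<chi> i j. lim (\<lambda>k. X k $ i $ j))"
  have L: "(\<lambda>k. X k $ i $ j) \<longlonglongrightarrow> L $ i $ j" for i j
    using lim by (simp add: L_def)
  have L_qf: "(\<lambda>k. qf (X k) x) \<longlonglongrightarrow> qf L x" for x
    unfolding qf_def cinner_def matrix_vector_mult_def vec_lambda_beta
    by (intro tendsto_Re tendsto_sum tendsto_mult L tendsto_cnj tendsto_const)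
  have "cnj (L $ i $ j) = L $ j $ i" for i j
  proof (rule LIMSEQ_unique[OF _ L])
    have "X k $ j $ i = cnj (X k $ i $ j)" for k
      using arg_cong[OF herm[of k], of "\<lambda>M. M $ j $ i"] by (simp add: ctranspose_def)
    then show "(\<lambda>k. X k $ j $ i) \<longlonglongrightarrow> cnj (L $ i $ j)"
      using tendsto_cnj[OF L] by simp
  qed
  then have L_herm: "ctranspose L = L"
    by (simp add: ctranspose_def vec_eq_iff)
  have below: "L \<preceq> X k" for k
    using decseq_ge[OF dec_qf L_qf] by (simp add: loewner_iff L_herm herm)
  have "0 \<le> qf L x" for x
    by (rule LIMSEQ_le_const[OF L_qf]) (use psd psd_qf in blast)
  then have "psd L" by (simp add: psd_def L_herm)
  moreover have "\<forall>\<^sub>F k in sequentially. X k \<preceq> L + e *\<^sub>R mat 1" if "0 < e" for e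
  proof -
    define s where "s k = (\<Sum>i\<in>UNIV. \<Sum>j\<in>UNIV. cmod ((X k - L) $ i $ j))" for k
    have "s \<longlonglongrightarrow> (\<Sum>i\<in>UNIV. \<Sum>j\<in>UNIV. cmod (L $ i $ j - L $ i $ j))"
      unfolding s_def vector_minus_component
      by (intro tendsto_sum tendsto_norm tendsto_diff L tendsto_const)
    then have "s \<longlonglongrightarrow> 0" by simp
    then have "\<forall>\<^sub>F k in sequentially. s k < e"
      using \<open>0 < e\<close> by (rule order_tendstoD(2))
    then show ?thesis
    proof eventually_elim
      case (elim k)
      have "qf (X k) x \<le> qf (L + e *\<^sub>R mat 1) x" for x
      proof -
        have "qf (X k - L) x \<le> s k * (norm x)\<^sup>2" unfolding s_def by (rule qf_le_entries)
        also have "\<dots> \<le> e * (norm x)\<^sup>2" using elim by (intro mult_right_mono) auto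
        finally show ?thesis by (simp add: qf_simps)
      qed
      then show ?case by (subst loewner_iff) (simp_all add: herm L_herm ctranspose_simps)
    qed
  qed
  ultimately show ?thesis using below that by (simp add: lim_above_def)
qed

text \<open>X vanishes on the orthogonal complement of u, so its quadratic form sees only the
  component along u.\<close>

lemma psd_le_outer:
  assumes X: "psd X" and le: "X \<preceq> outer u"
  shows "\<exists>c. X = c *\<^sub>R outer u"
proof (cases "u = 0")
  case True
  then have "X = 0"
    using loewner_antisym[OF X psd_zero] le X loewner_zero outer_zero by metis
  then show ?thesis using True by simp
next
  case False
  have ker: "X *v x = 0" if "cinner x u = 0" for x
  proof -
    have "qf X x \<le> 0" using loewner_qf[OF le, of x] that by (simp add: qf_outer)
    then show ?thesis using X psd_qf[OF X, of x] by (intro psd_qf_eq_0_imp) auto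
  qed
  \<comment> \<open>The denominator is \<open>qf (outer u) u\<close>.\<close>
  define c where "c = qf X u / (norm u) ^ 4"
  have "qf X x = qf (c *\<^sub>R outer u) x" for x
  proof -
    define \<alpha> where "\<alpha> = cinner x u / cinner u u"
    define y where "y = x - \<alpha> *s u"
    have "cinner y u = 0" using False by (simp add: y_def \<alpha>_def cinner_diff_left)
    then have "qf X (y + \<alpha> *s u) = qf X (\<alpha> *s u)"
      unfolding qf_add_vec[OF psd_hermitian[OF X]] by (simp add: ker) (simp add: qf_def ker)
    then have "qf X x = (cmod \<alpha>)\<^sup>2 * qf X u" by (simp add: y_def qf_scale_vec)
    moreover have "cmod \<alpha> = cmod (cinner x u) / (norm u)\<^sup>2"
      by (simp add: \<alpha>_def norm_divide cinner_self norm_power)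
    ultimately show ?thesis by (simp add: qf_simps c_def power_divide)
  qed
  then have "X = c *\<^sub>R outer u"
    using X by - (rule hermitian_eqI, simp_all add: psd_hermitian ctranspose_scaleR)
  then show ?thesis by blast
qed

lemma scaleR_psd_comparable: "psd D \<Longrightarrow> a *\<^sub>R D \<preceq> b *\<^sub>R D \<or> b *\<^sub>R D \<preceq> a *\<^sub>R D"
  using psd_scaleR[of D "b - a"] psd_scaleR[of D "a - b"]
  by (cases "a \<le> b") (auto simp: loewner_def scaleR_left_diff_distrib)

text \<open>Two orthogonal eigenvectors with positive eigenvalues would give incomparable spectral
  pieces below the matrix.\<close>

lemma chain_imp_outer:
  fixes D :: "complex ^ 'n ^ 'n"
  assumes D: "psd D"
    and chain: "\<And>X Y. psd X \<Longrightarrow> psd Y \<Longrightarrow> X \<preceq> D \<Longrightarrow> Y \<preceq> D \<Longrightarrow> X \<preceq> Y \<or> Y \<preceq> X"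
  shows "\<exists>u. D = outer u"
proof -
  obtain U d where dg: "diagonalises U d D"
    using D psd_hermitian hermitian_diagonalises by blast
  have U: "unitary_matrix U" using dg by (simp add: diagonalises_def)
  have d: "0 \<le> d i" for i using diagonalises_psd[OF dg] D by simp
  define P where "P i = d i *\<^sub>R outer (column i U)" for i
  have P: "psd (P i)" for i using d by (simp add: P_def psd_scaleR)
  have qP: "qf (P i) x = d i * (cmod (cinner x (column i U)))\<^sup>2" for i x
    by (simp add: P_def qf_simps)
  have "qf (P i) x \<le> qf D x" for i x
    unfolding qP diagonalises_qf[OF dg] using d by (intro member_le_sum) auto
  then have PD: "P i \<preceq> D" for i
    using P D by (simp add: loewner_iff psd_hermitian)
  have uniq: "d i = 0" if "i \<noteq> j" "d j \<noteq> 0" for i j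
  proof (rule ccontr)
    assume "d i \<noteq> 0"
    have "qf (P i) (column i U) = d i" "qf (P j) (column j U) = d j"
      "qf (P i) (column j U) = 0" "qf (P j) (column i U) = 0"
      using that(1) by (auto simp: qP unitary_columns[OF U])
    moreover have "0 < d i" "0 < d j" using d[of i] d[of j] \<open>d i \<noteq> 0\<close> that(2) by auto
    ultimately show False
      using chain[OF P P PD PD, of i j] loewner_qf[of "P i" "P j" "column i U"]
        loewner_qf[of "P j" "P i" "column j U"] by auto
  qed
  \<comment> \<open>If all eigenvalues are zero, any j serves and D is
    \<open>outer 0\<close>.\<close>
  obtain j where j: "\<And>i. i \<noteq> j \<Longrightarrow> d i = 0"
    using uniq by (cases "\<exists>j. d j \<noteq> 0") auto
  have "qf D x = qf (outer (sqrt (d j) *\<^sub>R column j U)) x" for x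
    unfolding diagonalises_qf[OF dg] outer_scaleR
    using j d[of j] by (simp add: sum.remove[of UNIV j] qf_simps)
  then have "D = outer (sqrt (d j) *\<^sub>R column j U)"
    using D by - (rule hermitian_eqI, simp_all add: psd_hermitian)
  then show ?thesis by blast
qed

text \<open>The inverse \<psi> is a parameter to make the locale symmetric: by
  \<open>inverse_automorphism\<close> every result holds for \<psi> as well. Nothing is assumed
  outside the positive definite matrices.\<close>

locale order_automorphism =
  fixes \<phi> \<psi> :: "complex ^ 'n ^ 'n \<Rightarrow> complex ^ 'n ^ 'n"
  assumes \<phi>_pd: "\<And>A. positive_definite A \<Longrightarrow> positive_definite (\<phi> A)"
    and \<psi>_pd: "\<And>A. positive_definite A \<Longrightarrow> positive_definite (\<psi> A)"
    and \<phi>_\<psi>: "\<And>A. positive_definite A \<Longrightarrow> \<phi> (\<psi> A) = A"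
    and \<psi>_\<phi>: "\<And>A. positive_definite A \<Longrightarrow> \<psi> (\<phi> A) = A"
    and \<phi>_le_iff: "\<And>A B. positive_definite A \<Longrightarrow> positive_definite B \<Longrightarrow> \<phi> A \<preceq> \<phi> B \<longleftrightarrow> A \<preceq> B"
begin

lemma inverse_automorphism: "order_automorphism \<psi> \<phi>"
  by unfold_locales (use \<phi>_pd \<psi>_pd \<phi>_\<psi> \<psi>_\<phi> \<phi>_le_iff in \<open>auto simp flip: \<phi>_le_iff\<close>)

lemma \<psi>_le_iff: "positive_definite A \<Longrightarrow> positive_definite B \<Longrightarrow> \<psi> A \<preceq> \<psi> B \<longleftrightarrow> A \<preceq> B"
  using order_automorphism.\<phi>_le_iff[OF inverse_automorphism] .

lemma decreasing_image:
  assumes "psd A"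
  obtains L where "psd L" "lim_above (\<lambda>k. \<phi> (A + (1 / real (Suc k)) *\<^sub>R mat 1)) L"
proof (rule decreasing_psd_converges)
  have pd: "positive_definite (A + (1 / real (Suc k)) *\<^sub>R mat 1)" for k
    using assms by (intro psd_plus_scalar) auto
  show "psd (\<phi> (A + (1 / real (Suc k)) *\<^sub>R mat 1))" for k
    using pd \<phi>_pd positive_definite_imp_psd by blast
  show "\<phi> (A + (1 / real (Suc m)) *\<^sub>R mat 1) \<preceq> \<phi> (A + (1 / real (Suc k)) *\<^sub>R mat 1)" if "k \<le> m" for k m
    unfolding \<phi>_le_iff[OF pd pd] using that
    by (auto simp: loewner_def intro!: psd_scaleR divide_left_mono simp flip: scaleR_left_diff_distrib)
qed (use that in blast)

text \<open>It amounts to continuity of \<psi> from above at \<phi> A: the images under \<psi> of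
  \<phi> A + 1/(k+1) decrease to a limit L, and the order forces L = A. So some image is already
  below B, and applying \<phi> leaves room 1/(j+1) between \<phi> A and \<phi> B.\<close>

lemma strict_mono:
  assumes A: "positive_definite A" and B: "positive_definite B" and AB: "A \<prec>\<prec> B"
  shows "\<phi> A \<prec>\<prec> \<phi> B"
proof -
  define E where "E k = \<phi> A + (1 / real (Suc k)) *\<^sub>R mat 1" for k
  have E: "positive_definite (E k)" for k
    unfolding E_def using A \<phi>_pd positive_definite_imp_psd by (intro psd_plus_scalar) auto
  obtain L where L: "psd L" "lim_above (\<lambda>k. \<psi> (E k)) L"
    unfolding E_def
    using order_automorphism.decreasing_image[OF inverse_automorphism] A \<phi>_pd positive_definite_imp_psd
    by metis
  have "A \<preceq> \<psi> (E k)" for k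
  proof -
    have "\<phi> A \<preceq> E k"
      unfolding E_def by (intro loewner_strict_imp_le loewner_strict_add_scalar) simp
    then show ?thesis
      using \<phi>_le_iff[OF A \<psi>_pd[OF E]] by (simp add: \<phi>_\<psi> E)
  qed
  have "A \<preceq> L"
  proof (rule loewner_archimedean)
    fix k
    have "\<forall>\<^sub>F j in sequentially. \<psi> (E j) \<preceq> L + (1 / real (Suc k)) *\<^sub>R mat 1"
      using L(2) by (simp add: lim_above_def)
    then obtain j where "\<psi> (E j) \<preceq> L + (1 / real (Suc k)) *\<^sub>R mat 1"
      using eventually_happens by force
    then show "A \<preceq> L + (1 / real (Suc k)) *\<^sub>R mat 1"
      using \<open>\<And>k. A \<preceq> \<psi> (E k)\<close> loewner_trans by blast
  qed (use A L in \<open>auto simp: psd_hermitian positive_definite_imp_psd\<close>)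
  \<comment> \<open>A limit is a priori only semidefinite; lying above A brings L back to where
    \<phi> is controlled.\<close>
  then have L_pd: "positive_definite L" using A positive_definite_loewner by blast
  have "\<phi> L \<preceq> \<phi> A"
  proof (rule loewner_archimedean)
    fix k
    have "L \<preceq> \<psi> (E k)" using L(2) by (simp add: lim_above_def)
    then have "\<phi> L \<preceq> E k" using \<phi>_le_iff[OF L_pd \<psi>_pd[OF E]] by (simp add: \<phi>_\<psi> E)
    then show "\<phi> L \<preceq> \<phi> A + (1 / real (Suc k)) *\<^sub>R mat 1" by (simp add: E_def)
  qed (use A L_pd \<phi>_pd in \<open>auto simp: psd_hermitian positive_definite_imp_psd\<close>)
  then have "L \<preceq> A" using \<phi>_le_iff[OF L_pd A] by simp
  obtain e where e: "0 < e" "A + e *\<^sub>R mat 1 \<preceq> B" using loewner_strict_gap[OF AB] .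
  have "\<forall>\<^sub>F j in sequentially. \<psi> (E j) \<preceq> L + e *\<^sub>R mat 1"
    using L(2) e(1) by (simp add: lim_above_def)
  then obtain j where "\<psi> (E j) \<preceq> L + e *\<^sub>R mat 1"
    using eventually_happens by force
  also have "L + e *\<^sub>R mat 1 \<preceq> A + e *\<^sub>R mat 1" using \<open>L \<preceq> A\<close> by (simp add: loewner_def)
  finally (loewner_trans) have "\<psi> (E j) \<preceq> B" using e(2) loewner_trans by blast
  then have "E j \<preceq> \<phi> B" using \<phi>_le_iff[OF \<psi>_pd[OF E] B] by (simp add: \<phi>_\<psi> E)
  then show ?thesis
    using loewner_strict_le_trans[OF loewner_strict_add_scalar[of "1 / real (Suc j)" "\<phi> A"]]
    by (simp add: E_def)
qed

lemma strict_iff: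
  assumes "positive_definite A" "positive_definite B"
  shows "\<phi> A \<prec>\<prec> \<phi> B \<longleftrightarrow> A \<prec>\<prec> B"
  using strict_mono[OF assms] order_automorphism.strict_mono[OF inverse_automorphism, of "\<phi> A" "\<phi> B"]
  by (auto simp: \<phi>_pd \<psi>_\<phi> assms)

text \<open>The extension of the automorphism to semidefinite matrices, as a relation: the second matrix is
  the infimum of the images of the strict upper bounds of the first.\<close>

definition ext :: "complex ^ 'n ^ 'n \<Rightarrow> complex ^ 'n ^ 'n \<Rightarrow> bool" where
  "ext A L \<longleftrightarrow> psd A \<and> psd L \<and> (\<forall>B. positive_definite B \<longrightarrow> (A \<prec>\<prec> B \<longleftrightarrow> L \<prec>\<prec> \<phi> B))"

lemma ext_psd: "ext A L \<Longrightarrow> psd A" "ext A L \<Longrightarrow> psd L"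
  by (simp_all add: ext_def)

text \<open>Both sides are statements about strict upper bounds, and \<phi> B runs through all
  positive definite matrices as B does.\<close>

lemma ext_le_iff:
  assumes "ext A L" "ext A' L'"
  shows "A \<preceq> A' \<longleftrightarrow> L \<preceq> L'"
proof -
  have "A \<preceq> A' \<longleftrightarrow> (\<forall>B. positive_definite B \<longrightarrow> L' \<prec>\<prec> \<phi> B \<longrightarrow> L \<prec>\<prec> \<phi> B)"
    using assms by (simp add: ext_def psd_le_iff_strict_upper_bounds)
  also have "\<dots> \<longleftrightarrow> L \<preceq> L'"
    using assms by (simp add: ext_def psd_le_iff_strict_upper_bounds) (metis \<phi>_pd \<psi>_pd \<phi>_\<psi>)
  finally show ?thesis .
qed

lemma ext_unique: "ext A L \<Longrightarrow> ext A L' \<Longrightarrow> L = L'"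
  by (meson ext_le_iff ext_psd(2) loewner_antisym loewner_refl)

text \<open>The limit L has the right strict upper bounds because a strict inequality leaves a gap
  e, into which a late term of the sequence fits.\<close>

lemma ext_total:
  assumes "psd A"
  obtains L where "ext A L" "lim_above (\<lambda>k. \<phi> (A + (1 / real (Suc k)) *\<^sub>R mat 1)) L"
proof -
  obtain L where L: "psd L" "lim_above (\<lambda>k. \<phi> (A + (1 / real (Suc k)) *\<^sub>R mat 1)) L"
    using decreasing_image assms by blast
  have pd: "positive_definite (A + (1 / real (Suc k)) *\<^sub>R mat 1)" for k
    using assms by (intro psd_plus_scalar) auto
  have "A \<prec>\<prec> B \<longleftrightarrow> L \<prec>\<prec> \<phi> B" if B: "positive_definite B" for B
  proof
    assume "A \<prec>\<prec> B"
    then obtain e where e: "0 < e" "A + e *\<^sub>R mat 1 \<preceq> B" using loewner_strict_gap by blast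
    obtain k where k: "1 / real (Suc k) < e" using e(1) nat_approx_posE by blast
    have "A + (1 / real (Suc k)) *\<^sub>R mat 1 \<prec>\<prec> A + e *\<^sub>R mat 1"
      using k by (simp add: loewner_strict_def positive_definite_scaleR flip: scaleR_left_diff_distrib)
    then have "\<phi> (A + (1 / real (Suc k)) *\<^sub>R mat 1) \<prec>\<prec> \<phi> B"
      using e(2) loewner_strict_le_trans by (intro strict_mono pd B) blast
    moreover have "L \<preceq> \<phi> (A + (1 / real (Suc k)) *\<^sub>R mat 1)"
      using L(2) by (simp add: lim_above_def)
    ultimately show "L \<prec>\<prec> \<phi> B" using loewner_le_strict_trans by blast
  next
    assume "L \<prec>\<prec> \<phi> B"
    then obtain e where e: "0 < e" "L + e *\<^sub>R mat 1 \<preceq> \<phi> B" using loewner_strict_gap by blast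
    then have "\<forall>\<^sub>F k in sequentially. \<phi> (A + (1 / real (Suc k)) *\<^sub>R mat 1) \<preceq> L + e *\<^sub>R mat 1"
      using L(2) by (simp add: lim_above_def)
    then obtain k where "\<phi> (A + (1 / real (Suc k)) *\<^sub>R mat 1) \<preceq> L + e *\<^sub>R mat 1"
      using eventually_happens by force
    then have "\<phi> (A + (1 / real (Suc k)) *\<^sub>R mat 1) \<preceq> \<phi> B" using e(2) loewner_trans by blast
    then have "A + (1 / real (Suc k)) *\<^sub>R mat 1 \<preceq> B" using \<phi>_le_iff[OF pd B] by simp
    then show "A \<prec>\<prec> B"
      using loewner_strict_le_trans loewner_strict_add_scalar[of "1 / real (Suc k)" A] by auto
  qed
  then have "ext A L" using assms L(1) by (simp add: ext_def)
  then show ?thesis using L(2) that by blast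
qed

lemma ext_surj:
  assumes "psd L"
  obtains A where "ext A L"
proof -
  obtain A where "order_automorphism.ext \<psi> L A"
    using order_automorphism.ext_total[OF inverse_automorphism assms] by blast
  then have "psd A" and "\<And>B. positive_definite B \<Longrightarrow> L \<prec>\<prec> B \<longleftrightarrow> A \<prec>\<prec> \<psi> B"
    by (simp_all add: order_automorphism.ext_def[OF inverse_automorphism])
  then have "ext A L" using assms \<phi>_pd \<psi>_\<phi> by (simp add: ext_def)
  then show ?thesis using that by blast
qed

lemma ext_positive_definite: "positive_definite A \<Longrightarrow> ext A (\<phi> A)"
  by (simp add: ext_def strict_iff \<phi>_pd positive_definite_imp_psd)

lemma ext_lim_above:
  "ext A L \<Longrightarrow> lim_above (\<lambda>k. \<phi> (A + (1 / real (Suc k)) *\<^sub>R mat 1)) L"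
  by (metis ext_psd(1) ext_total ext_unique)

text \<open>0 is the least element of the closed cone on either side.\<close>

lemma ext_zero: "ext 0 0"
proof -
  obtain A where A: "ext A 0" using ext_surj[OF psd_zero] .
  obtain L where L: "ext 0 L" using ext_total[OF psd_zero] by blast
  have "L \<preceq> 0" using ext_le_iff[OF L A] ext_psd(1)[OF A] by (simp add: loewner_zero)
  then have "L = 0" using loewner_antisym ext_psd(2)[OF L] loewner_zero psd_zero by blast
  then show ?thesis using L by simp
qed

lemma ext_outer:
  assumes "ext (outer u) L"
  shows "\<exists>w. L = outer w"
proof (rule chain_imp_outer)
  show "psd L" using assms by (rule ext_psd)
  fix X Y assume *: "psd X" "psd Y" "X \<preceq> L" "Y \<preceq> L"
  obtain X' Y' where ext: "ext X' X" "ext Y' Y" using ext_surj *(1,2) by metis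
  then have "X' \<preceq> outer u" "Y' \<preceq> outer u" using ext_le_iff assms *(3,4) by blast+
  then obtain a b where "X' = a *\<^sub>R outer u" "Y' = b *\<^sub>R outer u"
    using psd_le_outer ext ext_psd(1) by metis
  then have "X' \<preceq> Y' \<or> Y' \<preceq> X'" by (simp add: scaleR_psd_comparable)
  then show "X \<preceq> Y \<or> Y \<preceq> X" using ext_le_iff ext by blast
qed

text \<open>The order interval from A to A + \<open>outer v\<close> is a chain, hence so is its
  image; shifted by - \<phi> A this is the interval below D. All matrices between the end points are
  positive definite, so \<phi> and \<psi> themselves are applied here.\<close>

lemma image_plus_outer:
  assumes A: "positive_definite A"
  obtains z where "\<phi> (A + outer v) = \<phi> A + outer z"
proof -
  define D where "D = \<phi> (A + outer v) - \<phi> A"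
  have Av: "positive_definite (A + outer v)" using A by (intro positive_definite_add_psd) auto
  have "A \<preceq> A + outer v" by (simp add: loewner_def)
  then have D: "psd D" using \<phi>_le_iff[OF A Av] by (simp add: loewner_def D_def)
  have multiple: "\<exists>a. \<psi> (\<phi> A + X) = A + a *\<^sub>R outer v \<and> positive_definite (\<phi> A + X)"
    if X: "psd X" "X \<preceq> D" for X
  proof -
    have pd: "positive_definite (\<phi> A + X)" using A \<phi>_pd X(1) by (intro positive_definite_add_psd)
    have "\<phi> A \<preceq> \<phi> A + X" using X(1) by (simp add: loewner_def)
    then have 1: "A \<preceq> \<psi> (\<phi> A + X)"
      using \<psi>_le_iff[OF \<phi>_pd[OF A] pd] by (simp add: \<psi>_\<phi> A)
    have "\<phi> A + X \<preceq> \<phi> (A + outer v)"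
      using X(2) by (simp add: loewner_def D_def algebra_simps)
    then have 2: "\<psi> (\<phi> A + X) \<preceq> A + outer v"
      using \<psi>_le_iff[OF pd \<phi>_pd[OF Av]] by (simp add: \<psi>_\<phi> Av)
    have "psd (\<psi> (\<phi> A + X) - A)" "\<psi> (\<phi> A + X) - A \<preceq> outer v"
      using 1 2 by (simp_all add: loewner_def algebra_simps)
    then obtain a where "\<psi> (\<phi> A + X) - A = a *\<^sub>R outer v" using psd_le_outer by blast
    then show ?thesis using pd by (metis add.commute diff_add_cancel)
  qed
  have "\<exists>z. D = outer z"
  proof (rule chain_imp_outer[OF D])
    fix X Y assume *: "psd X" "psd Y" "X \<preceq> D" "Y \<preceq> D"
    obtain a b where a: "\<psi> (\<phi> A + X) = A + a *\<^sub>R outer v" "positive_definite (\<phi> A + X)"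
      and b: "\<psi> (\<phi> A + Y) = A + b *\<^sub>R outer v" "positive_definite (\<phi> A + Y)"
      using multiple * by metis
    have "\<psi> (\<phi> A + X) \<preceq> \<psi> (\<phi> A + Y) \<or> \<psi> (\<phi> A + Y) \<preceq> \<psi> (\<phi> A + X)"
      using scaleR_psd_comparable[of "outer v" a b] by (simp add: a(1) b(1) loewner_def)
    then have "\<phi> A + X \<preceq> \<phi> A + Y \<or> \<phi> A + Y \<preceq> \<phi> A + X"
      using \<psi>_le_iff a(2) b(2) by blast
    then show "X \<preceq> Y \<or> Y \<preceq> X" by (simp add: loewner_def)
  qed
  then show ?thesis using that by (metis D_def add.commute diff_add_cancel)
qed

end

section \<open>Wigner's theorem\<close>

text \<open>The model of an antiunitary operator: all others are this map followed by a unitary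
  matrix.\<close>

definition cnjv :: "complex ^ 'n \<Rightarrow> complex ^ 'n" where
  "cnjv x = (\<chi> i. cnj (x $ i))"

lemma cmod_add_squared: "(cmod (z + w))\<^sup>2 = (cmod z)\<^sup>2 + (cmod w)\<^sup>2 + 2 * Re (z * cnj w)"
  unfolding cmod_power2 by (simp add: power2_eq_square algebra_simps)

lemma cinner_two_axes:
  assumes "i \<noteq> j" "\<forall>m. m \<noteq> i \<longrightarrow> m \<noteq> j \<longrightarrow> y $ m = 0"
  shows "cinner x y = x $ i * cnj (y $ i) + x $ j * cnj (y $ j)"
proof -
  have "cinner x y = (\<Sum>m\<in>{i, j}. x $ m * cnj (y $ m))"
    unfolding cinner_def by (rule sum.mono_neutral_right) (use assms(2) in auto)
  then show ?thesis using assms(1) by simp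
qed

text \<open>Testing against e_i + e_j recovers the real part of the product of x_i with the
  conjugate of x_j, and testing against e_i + i e_j its imaginary part up to a sign that depends on
  the pair only. The signs of all pairs agree, and these products are the entries of
  \<open>outer x\<close>.\<close>

lemma wigner_normalised:
  fixes S :: "complex ^ 'n \<Rightarrow> complex ^ 'n"
  assumes pres: "\<And>x y. cmod (cinner (S x) (S y)) = cmod (cinner x y)"
    and one: "S (\<chi> i. 1) = (\<chi> i. 1)"
    and entries: "\<And>x i. cmod (S x $ i) = cmod (x $ i)"
  shows "(\<forall>x. outer (S x) = outer x) \<or> (\<forall>x. outer (S x) = outer (cnjv x))"
proof -
  have Re_eq: "Re (S x $ i * cnj (S x $ j)) = Re (x $ i * cnj (x $ j))" if ij: "i \<noteq> j" for i j x
  proof -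
    define p :: "complex ^ 'n" where "p = axis i 1 + axis j 1"
    have p: "p $ i = 1" "p $ j = 1" "\<forall>m. m \<noteq> i \<longrightarrow> m \<noteq> j \<longrightarrow> p $ m = 0"
      using ij by (simp_all add: p_def axis_def)
    have Sp: "cmod (S p $ i) = 1" "cmod (S p $ j) = 1" "\<forall>m. m \<noteq> i \<longrightarrow> m \<noteq> j \<longrightarrow> S p $ m = 0"
      using entries[of p i] entries[of p j] p by (simp_all, metis entries norm_eq_zero)
    have "cmod (S p $ i + S p $ j) = cmod (cinner (S (\<chi> i. 1)) (S p))"
      unfolding one cinner_two_axes[OF ij Sp(3)]
      by (simp flip: complex_cnj_add)
    also have "\<dots> = 2"
      unfolding pres cinner_two_axes[OF ij p(3)] by (simp add: p)
    finally have "(cmod (S p $ i + S p $ j))\<^sup>2 = 4" by simp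
    \<comment> \<open>Two numbers of modulus 1 whose sum has modulus 2 are equal, by the
      parallelogram identity.\<close>
    then have "(cmod (S p $ i - S p $ j))\<^sup>2 = 0"
      using cmod_add_squared[of "S p $ i" "S p $ j"] cmod_add_squared[of "S p $ i" "- S p $ j"] Sp
      by simp
    then have eq: "S p $ j = S p $ i" by simp
    have "cmod (S x $ i + S x $ j) = cmod (cinner (S x) (S p))"
      unfolding cinner_two_axes[OF ij Sp(3)] eq
      by (simp add: norm_mult Sp flip: distrib_right)
    also have "\<dots> = cmod (x $ i + x $ j)"
      unfolding pres cinner_two_axes[OF ij p(3)] by (simp add: p)
    finally show ?thesis
      using cmod_add_squared[of "S x $ i" "S x $ j"] cmod_add_squared[of "x $ i" "x $ j"]
      by (simp add: entries)
  qed
  define same where "same i j \<longleftrightarrow> (\<forall>x. S x $ i * cnj (S x $ j) = x $ i * cnj (x $ j))" for i j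
  define conj where "conj i j \<longleftrightarrow> (\<forall>x. S x $ i * cnj (S x $ j) = cnj (x $ i * cnj (x $ j)))" for i j
  have same_conj: "same i j \<or> conj i j" if ij: "i \<noteq> j" for i j
  proof -
    define q :: "complex ^ 'n" where "q = axis i 1 + axis j \<i>"
    have q: "q $ i = 1" "q $ j = \<i>" "\<forall>m. m \<noteq> i \<longrightarrow> m \<noteq> j \<longrightarrow> q $ m = 0"
      using ij by (simp_all add: q_def axis_def)
    have Sq: "cmod (S q $ i) = 1" "cmod (S q $ j) = 1" "\<forall>m. m \<noteq> i \<longrightarrow> m \<noteq> j \<longrightarrow> S q $ m = 0"
      using entries[of q i] entries[of q j] q by (simp_all, metis entries norm_eq_zero)
    \<comment> \<open>The image of e_i + i e_j decides the type of the pair: c = - i means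
      unchanged, c = i conjugated.\<close>
    define c where "c = S q $ i * cnj (S q $ j)"
    have "Re c = 0" using Re_eq[OF ij, of q] by (simp add: c_def q)
    moreover have "cmod c = 1" by (simp add: c_def norm_mult Sq)
    ultimately have "c = \<i> \<or> c = - \<i>"
      by (auto simp: cmod_def complex_eq_iff)
    moreover have Im_eq: "Re (S x $ i * cnj (S x $ j) * cnj c) = - Im (x $ i * cnj (x $ j))" for x
    proof -
      have "cmod (S x $ i * cnj (S q $ i) + S x $ j * cnj (S q $ j)) = cmod (x $ i + x $ j * cnj \<i>)"
        using pres[of x q] unfolding cinner_two_axes[OF ij Sq(3)] cinner_two_axes[OF ij q(3)]
        by (simp add: q)
      then have "(cmod (S x $ i * cnj (S q $ i) + S x $ j * cnj (S q $ j)))\<^sup>2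
          = (cmod (x $ i + x $ j * cnj \<i>))\<^sup>2" by simp
      then have "Re (S x $ i * cnj (S q $ i) * cnj (S x $ j * cnj (S q $ j)))
          = Re (x $ i * cnj (x $ j * cnj \<i>))"
        unfolding cmod_add_squared by (simp add: norm_mult entries[of x] Sq)
      then show ?thesis by (simp add: c_def mult_ac)
    qed
    ultimately show ?thesis
    proof (elim disjE)
      assume "c = \<i>"
      then have "conj i j"
        unfolding conj_def using Re_eq[OF ij] Im_eq by (auto simp: complex_eq_iff)
      then show ?thesis ..
    next
      assume "c = - \<i>"
      then have "same i j"
        unfolding same_def using Re_eq[OF ij] Im_eq
        by (auto simp: complex_eq_iff) (metis minus_diff_eq)
      then show ?thesis ..
    qed
  qed
  have diag: "same i i" "conj i i" for i
    by (simp_all add: same_def conj_def entries mult.commute flip: complex_norm_square)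
  have sym: "same i j \<Longrightarrow> same j i" "conj i j \<Longrightarrow> conj j i" for i j
    unfolding same_def conj_def by (metis complex_cnj_mult complex_cnj_cnj mult.commute)+
  \<comment> \<open>With entries i, 1, - i at the three places, the two products combine to the
    value 1 for the pair (i, k), whose real part must be -1.\<close>
  have mixed: False if ij: "same i j" and jk: "conj j k" and ne: "i \<noteq> j" "j \<noteq> k" "i \<noteq> k" for i j k
  proof -
    define x :: "complex ^ 'n" where "x = axis i \<i> + axis j 1 + axis k (- \<i>)"
    have x: "x $ i = \<i>" "x $ j = 1" "x $ k = - \<i>"
      using ne by (simp_all add: x_def axis_def)
    have "(S x $ i * cnj (S x $ j)) * (S x $ j * cnj (S x $ k)) = \<i> * (- \<i>)"
      using ij jk by (simp add: same_def conj_def x)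
    moreover have "cnj (S x $ j) * S x $ j = 1"
      using entries[of x j] x complex_norm_square[of "S x $ j"] by (simp add: mult.commute)
    then have "(S x $ i * cnj (S x $ j)) * (S x $ j * cnj (S x $ k)) = S x $ i * cnj (S x $ k)"
      by (metis mult.assoc mult.left_commute mult.right_neutral)
    ultimately show False
      using Re_eq[OF ne(3), of x] by (simp add: x)
  qed
  have "(\<forall>i j. same i j) \<or> (\<forall>i j. conj i j)"
  proof (rule ccontr)
    assume "\<not> ?thesis"
    then obtain a b c d where ab: "\<not> same a b" and cd: "\<not> conj c d" by blast
    have ne: "a \<noteq> b" "c \<noteq> d" using ab cd diag by blast+
    then have 1: "a \<noteq> b" "c \<noteq> d" "conj a b" "same c d"
      using ab cd same_conj by blast+
    \<comment> \<open>Two pairs of different type: sharing an index, they contradict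
      \<open>mixed\<close> at once; otherwise a pair joining them has one of the types and clashes
      with one of the two.\<close>
    have "\<not> (a = c \<and> b = d)" "\<not> (a = d \<and> b = c)" using 1 ab sym by blast+
    then show False
      using 1 mixed sym same_conj by metis
  qed
  then show ?thesis
  proof (elim disjE)
    assume "\<forall>i j. same i j"
    then have "\<forall>x. outer (S x) = outer x"
      by (simp add: same_def outer_def vec_eq_iff)
    then show ?thesis ..
  next
    assume "\<forall>i j. conj i j"
    then have "\<forall>x. outer (S x) = outer (cnjv x)"
      by (simp add: conj_def outer_def vec_eq_iff cnjv_def)
    then show ?thesis ..
  qed
qed

text \<open>The images of the standard basis are orthonormal, and with suitable phases they form a
  unitary matrix that reduces T to the normalised case. Stating the result for \<open>outer\<close>
  disregards the phase of each T x.\<close>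

theorem wigner:
  fixes T :: "complex ^ 'n \<Rightarrow> complex ^ 'n"
  assumes pres: "\<And>x y. cmod (cinner (T x) (T y)) = cmod (cinner x y)"
  obtains V where "unitary_matrix V"
    "(\<forall>x. outer (T x) = outer (V *v x)) \<or> (\<forall>x. outer (T x) = outer (V *v cnjv x))"
proof -
  define one :: "complex ^ 'n" where "one = (\<chi> i. 1)"
  define f where "f i = T (axis i 1)" for i
  \<comment> \<open>These phases make every coordinate of the normalised image of the all-ones
    vector equal to 1.\<close>
  define c where "c i = cinner (T one) (f i)" for i
  define V :: "complex ^ 'n ^ 'n" where "V = (\<chi> i j. (c j *s f j) $ i)"
  have c: "cmod (c i) = 1" for i
    by (simp add: c_def f_def pres cinner_axis one_def)
  have orth: "cinner (f i) (f j) = (if i = j then 1 else 0)" for i j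
  proof (cases "i = j")
    case True
    have "(norm (f i))\<^sup>2 = 1"
      using pres[of "axis i 1" "axis i 1"] by (simp add: f_def cinner_self cinner_axis norm_power)
    then show ?thesis using True by (simp add: cinner_self flip: of_real_power)
  next
    case False
    then have "cmod (cinner (f i) (f j)) = 0"
      unfolding f_def pres by (simp add: cinner_axis) (simp add: axis_def)
    then show ?thesis using False by simp
  qed
  have cc: "c i * cnj (c i) = 1" for i
    using c complex_norm_square[of "c i"] by simp
  have V: "unitary_matrix V"
    unfolding V_def by (rule unitary_matrixI_columns) (auto simp: orth cc mult.commute[of "cnj (c _)"])
  define S where "S x = ctranspose V *v T x" for x
  have S_nth: "S x $ i = cnj (c i) * cinner (T x) (f i)" for x i
    by (simp add: S_def V_def matrix_vector_mult_def ctranspose_def cinner_def sum_distrib_left mult_ac)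
  have VS: "V *v S x = T x" for x
    using V by (simp add: S_def matrix_vector_mul_assoc unitary_matrix_def)
  have S: "(\<forall>x. outer (S x) = outer x) \<or> (\<forall>x. outer (S x) = outer (cnjv x))"
  proof (rule wigner_normalised)
    show "cmod (cinner (S x) (S y)) = cmod (cinner x y)" for x y
      using V pres[of x y]
      by (simp add: S_def cinner_mult_mv matrix_vector_mul_assoc unitary_matrix_def)
    show "S (\<chi> i. 1) = (\<chi> i. 1)"
      using cc by (simp add: vec_eq_iff S_nth mult.commute flip: one_def c_def) (simp add: one_def)
    show "cmod (S x $ i) = cmod (x $ i)" for x i
      by (simp add: S_nth norm_mult c) (simp add: f_def pres cinner_axis)
  qed
  have outer_T: "outer (T x) = V ** outer (S x) ** ctranspose V" for x
    by (subst outer_mv_conj) (simp add: VS)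
  have "(\<forall>x. outer (T x) = outer (V *v x)) \<or> (\<forall>x. outer (T x) = outer (V *v cnjv x))"
    using S unfolding outer_T outer_mv_conj[symmetric] by metis
  then show ?thesis using V that by blast
qed

section \<open>Jensen divergence preservers\<close>

lemma trace_outer: "trace (outer u) = of_real ((norm u)\<^sup>2)"
  unfolding cinner_self[symmetric] by (simp add: trace_def outer_def cinner_def)

lemma trace_scaleR: "trace (r *\<^sub>R A) = r *\<^sub>R trace A" for A :: "complex ^ 'n ^ 'n"
  by (simp add: trace_def scaleR_sum_right)

lemma outer_eq_scaleR_norm:
  assumes "outer w = c *\<^sub>R outer u"
  shows "(norm w)\<^sup>2 = c * (norm u)\<^sup>2"
proof -
  have "trace (outer w) = c *\<^sub>R trace (outer u)" using assms by (simp add: trace_scaleR)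
  then have "complex_of_real ((norm w)\<^sup>2) = of_real (c * (norm u)\<^sup>2)"
    by (simp only: trace_outer) (simp add: scaleR_conv_of_real)
  then show ?thesis by (simp only: of_real_eq_iff)
qed

lemma outer_eq_0_iff [simp]: "outer u = 0 \<longleftrightarrow> u = 0"
  using outer_eq_scaleR_norm[of u 0 u] by auto

lemma cmod_cinner_self: "cmod (cinner x x) = (norm x)\<^sup>2"
  by (simp add: cinner_self norm_power)

text \<open>The projection of a to the line of b already has the norm of a, so the orthogonal
  remainder vanishes by Pythagoras and a is b times a phase.\<close>

lemma outer_eq_if_cauchy_schwarz_eq:
  assumes "cmod (cinner a b) = norm a * norm b" "norm a = norm b"
  shows "outer a = outer b"
proof (cases "b = 0")
  case False
  define \<alpha> where "\<alpha> = cinner a b / cinner b b"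
  have \<alpha>: "cmod \<alpha> = 1"
    using False assms
    by (simp add: \<alpha>_def norm_divide cinner_self norm_power norm_mult power2_eq_square)
  have "cinner (a - \<alpha> *s b) b = 0"
    using False by (simp add: \<alpha>_def cinner_diff_left)
  then have "cinner (\<alpha> *s b) (a - \<alpha> *s b) = 0"
    by (metis cinner_scale_left cnj_cinner complex_cnj_zero mult_zero_right)
  then have "(norm (\<alpha> *s b + (a - \<alpha> *s b)))\<^sup>2 = (norm (\<alpha> *s b))\<^sup>2 + (norm (a - \<alpha> *s b))\<^sup>2"
    using qf_add_vec[OF ctranspose_mat1, of "\<alpha> *s b" "a - \<alpha> *s b"]
    by (simp only: qf_mat1 matrix_vector_mul_lid zero_complex.sel mult_zero_right add_0_right)
  moreover have "(norm (\<alpha> *s b))\<^sup>2 = (norm b)\<^sup>2"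
    using qf_scale_vec[of "mat 1" \<alpha> b] by (simp add: \<alpha>)
  ultimately have a: "a = \<alpha> *s b" using assms(2) by simp
  have "\<alpha> * cnj \<alpha> = 1" using \<alpha> complex_norm_square[of \<alpha>] by simp
  then have "outer (\<alpha> *s b) = outer b"
    by (simp add: outer_def vec_eq_iff)
  then show ?thesis using a by simp
qed (use assms in simp)

text \<open>For invertible A this is the criterion that <A^-1 u, u> is at most 1; a preimage y in
  place of A^-1 u gives it a meaning for singular A.\<close>

lemma outer_le_iff_preimage:
  assumes A: "psd A" and y: "A *v y = u"
  shows "outer u \<preceq> A \<longleftrightarrow> qf A y \<le> 1"
proof
  assume "outer u \<preceq> A"
  then have "qf (outer u) y \<le> qf A y" by (rule loewner_qf)
  moreover have "cmod (cinner y u) = qf A y"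
  proof -
    have "cinner u y = of_real (qf A y)"
    proof (rule complex_eqI)
      show "Im (cinner u y) = Im (of_real (qf A y))"
        using hermitian_cinner_commute[OF psd_hermitian[OF A], of y y] y
        by (metis Im_complex_of_real cnj.simps(2) neg_equal_zero)
    qed (simp add: qf_def y)
    then show ?thesis using psd_qf[OF A, of y] by (metis abs_of_nonneg cmod_cinner_commute norm_of_real)
  qed
  ultimately have "(qf A y)\<^sup>2 \<le> qf A y" by (simp add: qf_outer)
  then show "qf A y \<le> 1"
    using psd_qf[OF A, of y] by (cases "qf A y = 0") (simp_all add: power2_eq_square)
next
  assume le: "qf A y \<le> 1"
  have "qf (outer u) x \<le> qf A x" for x
  proof -
    have "qf (outer u) x = (cmod (cinner (A *v y) x))\<^sup>2"
      by (simp add: qf_outer y cmod_cinner_commute)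
    also have "\<dots> \<le> qf A y * qf A x" using A by (rule psd_cauchy_schwarz)
    also have "\<dots> \<le> 1 * qf A x" using le psd_qf[OF A] by (intro mult_right_mono)
    finally show ?thesis by simp
  qed
  then show "outer u \<preceq> A" using A by (simp add: loewner_iff psd_hermitian)
qed

text \<open>For y scaled to \<open>qf A y = 1\<close>, the minorant \<open>outer (A *v y)\<close>
  touches A in the direction y, so B has at least the value 1 there.\<close>

lemma loewner_if_outer_minorants:
  assumes A: "psd A" and B: "psd B" and min: "\<And>u. outer u \<preceq> A \<Longrightarrow> outer u \<preceq> B"
  shows "A \<preceq> B"
proof -
  have "qf A x \<le> qf B x" for x
  proof (cases "qf A x = 0")
    case False
    define a where "a = qf A x"
    have a: "0 < a" using False psd_qf[OF A, of x] by (simp add: a_def)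
    define y where "y = (1 / sqrt a) *\<^sub>R x"
    have "qf A y = 1" using a by (simp add: y_def qf_scaleR_vec power_divide a_def)
    then have "outer (A *v y) \<preceq> A" using outer_le_iff_preimage[OF A, of y] by simp
    then have "qf (outer (A *v y)) y \<le> qf B y" using min loewner_qf by blast
    moreover have "1 \<le> qf (outer (A *v y)) y"
    proof -
      have "qf A y \<le> cmod (cinner (A *v y) y)" unfolding qf_def by (rule complex_Re_le_cmod)
      then show ?thesis
        using \<open>qf A y = 1\<close> by (simp add: qf_outer cmod_cinner_commute one_le_power)
    qed
    ultimately have "1 \<le> qf B y" by simp
    then show ?thesis using a by (simp add: y_def qf_scaleR_vec power_divide a_def pos_le_divide_eq)
  qed (use B psd_qf in auto)
  then show ?thesis using A B by (simp add: loewner_iff psd_hermitian)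
qed

lemma eq_if_outer_minorants:
  assumes "psd A" "psd B" "\<And>u. outer u \<preceq> A \<longleftrightarrow> outer u \<preceq> B"
  shows "A = B"
  using loewner_antisym loewner_if_outer_minorants assms by metis

text \<open>The Sherman-Morrison formula provides the preimage y of u needed for
  \<open>outer_le_iff_preimage\<close>.\<close>

lemma outer_le_mat1_plus_outer_iff:
  "outer u \<preceq> mat 1 + outer v \<longleftrightarrow>
     (norm u)\<^sup>2 - (cmod (cinner u v))\<^sup>2 / (1 + (norm v)\<^sup>2) \<le> 1"
proof -
  define r where "r = 1 + (norm v)\<^sup>2"
  have r: "0 < r" unfolding r_def by (metis add_pos_nonneg zero_le_power2 zero_less_one)
  define y where "y = u - (cinner u v / of_real r) *s v"
  have "cinner y v = cinner u v - cinner u v * (of_real (r - 1) / of_real r)"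
    by (simp add: y_def cinner_diff_left cinner_self r_def)
  also have "\<dots> = cinner u v / of_real r" using r by (simp add: field_simps)
  finally have yv: "cinner y v = cinner u v / of_real r" .
  have y: "(mat 1 + outer v) *v y = u"
    by (simp add: matrix_vector_mult_add_rdistrib outer_mv yv) (simp add: y_def)
  have "psd (mat 1 + outer v)" by (intro psd_add) simp_all
  from outer_le_iff_preimage[OF this y]
  have "outer u \<preceq> mat 1 + outer v \<longleftrightarrow> Re (cinner u y) \<le> 1" by (simp add: qf_def y)
  also have "Re (cinner u y) = (norm u)\<^sup>2 - (cmod (cinner u v))\<^sup>2 / r"
  proof -
    have "cnj (cinner u v) * cinner u v = of_real ((cmod (cinner u v))\<^sup>2)"
      by (simp add: complex_norm_square mult.commute del: of_real_power)
    then have "cinner u y = of_real ((norm u)\<^sup>2 - (cmod (cinner u v))\<^sup>2 / r)"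
      by (simp add: y_def cinner_diff_right cinner_self)
    then show ?thesis by simp
  qed
  finally show ?thesis by (simp add: r_def)
qed

lemma outer_le_mat1_iff: "outer u \<preceq> mat 1 \<longleftrightarrow> norm u \<le> 1"
  using outer_le_mat1_plus_outer_iff[of u 0] by (simp add: abs_square_le_1)

lemma lim_above_add_scalar:
  "lim_above (\<lambda>k. A + (1 / real (Suc k)) *\<^sub>R mat 1) A"
proof -
  have "\<forall>\<^sub>F k in sequentially. A + (1 / real (Suc k)) *\<^sub>R mat 1 \<preceq> A + e *\<^sub>R mat 1" if "0 < e" for e
  proof -
    have "\<forall>\<^sub>F k in sequentially. 1 / real (Suc k) < e"
      using LIMSEQ_Suc[OF lim_1_over_n] that by (rule order_tendstoD(2))
    then show ?thesis
      by eventually_elim (auto simp: loewner_def intro!: psd_scaleR simp flip: scaleR_left_diff_distrib)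
  qed
  moreover have "A \<preceq> A + (1 / real (Suc k)) *\<^sub>R mat 1" for k
    by (rule loewner_strict_imp_le, rule loewner_strict_add_scalar) simp
  ultimately show ?thesis unfolding lim_above_def by blast
qed

section \<open>The action on rank one matrices\<close>

locale jensen_automorphism = jensen_function F F' l + order_automorphism \<phi> \<psi>
  for F F' l and \<phi> \<psi> :: "complex ^ 'n ^ 'n \<Rightarrow> complex ^ 'n ^ 'n" +
  assumes J_image: "\<And>A B. positive_definite A \<Longrightarrow> positive_definite B \<Longrightarrow> J (\<phi> A) (\<phi> B) = J A B"
begin

text \<open>Both arguments are approached from above by adding 1/(k+1); J is preserved along the way
  and converges on both sides.\<close>

lemma ext_J:
  assumes "ext A L" "ext A' L'"
  shows "J L L' = J A A'"
proof (rule LIMSEQ_unique)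
  have "positive_definite (B + (1 / real (Suc k)) *\<^sub>R mat 1)" if "psd B" for k B
    using that by (intro psd_plus_scalar) auto
  then have eq: "J (\<phi> (A + (1 / real (Suc k)) *\<^sub>R mat 1)) (\<phi> (A' + (1 / real (Suc k)) *\<^sub>R mat 1))
      = J (A + (1 / real (Suc k)) *\<^sub>R mat 1) (A' + (1 / real (Suc k)) *\<^sub>R mat 1)" for k
    using assms ext_psd(1) J_image by blast
  have "(\<lambda>k. J (\<phi> (A + (1 / real (Suc k)) *\<^sub>R mat 1)) (\<phi> (A' + (1 / real (Suc k)) *\<^sub>R mat 1)))
      \<longlonglongrightarrow> J L L'"
    using assms by (intro J_lim_above ext_lim_above) (auto simp: ext_psd)
  then show "(\<lambda>k. J (A + (1 / real (Suc k)) *\<^sub>R mat 1) (A' + (1 / real (Suc k)) *\<^sub>R mat 1))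
      \<longlonglongrightarrow> J L L'"
    unfolding eq .
  show "(\<lambda>k. J (A + (1 / real (Suc k)) *\<^sub>R mat 1) (A' + (1 / real (Suc k)) *\<^sub>R mat 1))
      \<longlonglongrightarrow> J A A'"
    using assms by (intro J_lim_above lim_above_add_scalar) (auto simp: ext_psd)
qed

lemma ext_inject: "ext A L \<Longrightarrow> ext A' L \<Longrightarrow> A = A'"
  by (meson ext_le_iff ext_psd(1) loewner_antisym loewner_refl)

lemma ext_outer_norm:
  assumes "ext (outer u) (outer w)"
  shows "norm w = norm u"
proof -
  have "u = 0 \<longleftrightarrow> w = 0"
    using assms ext_zero ext_unique ext_inject outer_eq_0_iff by metis
  then show ?thesis
    using J_outer_zero_inject[of w u] ext_J[OF assms ext_zero] by (cases "u = 0") auto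
qed

lemma ext_inverse:
  assumes "ext A L"
  shows "order_automorphism.ext \<psi> L A"
  using assms by (simp add: order_automorphism.ext_def[OF inverse_automorphism] ext_def \<psi>_pd \<phi>_\<psi>)

lemma ext_outer_surj:
  obtains u where "ext (outer u) (outer w)"
proof -
  obtain A where A: "ext A (outer w)" using ext_surj[OF psd_outer] .
  then have "\<exists>u. A = outer u"
    using order_automorphism.ext_outer[OF inverse_automorphism] ext_inverse by blast
  then show ?thesis using A that by blast
qed

lemma ext_outer_total:
  obtains w where "ext (outer u) (outer w)"
  using ext_total[OF psd_outer, of u] ext_outer by metis

lemma ext_outer_le_iff:
  "ext (outer u) (outer w) \<Longrightarrow> positive_definite A \<Longrightarrow> outer u \<preceq> A \<longleftrightarrow> outer w \<preceq> \<phi> A"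
  using ext_le_iff ext_positive_definite by blast

text \<open>\<open>outer u\<close> and its positive multiple are comparable, so their images are
  comparable and hence proportional; preservation of norms determines the factor.\<close>

lemma ext_outer_scaleR:
  assumes ext: "ext (outer u) (outer w)" and t: "0 < t"
  shows "ext (outer (t *\<^sub>R u)) (outer (t *\<^sub>R w))"
proof (cases "u = 0")
  case True
  then have "w = 0" using ext_outer_norm[OF ext] by simp
  then show ?thesis using True ext by simp
next
  case False
  obtain w' where w': "ext (outer (t *\<^sub>R u)) (outer w')" using ext_outer_total .
  have norms: "norm w = norm u" "norm w' = t * norm u"
    using ext_outer_norm[OF ext] ext_outer_norm[OF w'] t by simp_all
  have "outer u \<preceq> outer (t *\<^sub>R u) \<or> outer (t *\<^sub>R u) \<preceq> outer u"
    using scaleR_psd_comparable[of "outer u" 1 "t\<^sup>2"] by (simp add: outer_scaleR)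
  then have "outer w \<preceq> outer w' \<or> outer w' \<preceq> outer w"
    using ext_le_iff ext w' by blast
  then have "outer w' = t\<^sup>2 *\<^sub>R outer w"
  proof
    assume "outer w \<preceq> outer w'"
    then obtain c where c: "outer w = c *\<^sub>R outer w'" using psd_le_outer[OF psd_outer] by blast
    from outer_eq_scaleR_norm[OF c] have "t\<^sup>2 * c = 1"
      using norms False by (simp add: power_mult_distrib mult.commute)
    then show ?thesis using c by simp
  next
    assume "outer w' \<preceq> outer w"
    then obtain c where c: "outer w' = c *\<^sub>R outer w" using psd_le_outer[OF psd_outer] by blast
    from outer_eq_scaleR_norm[OF c] have "c = t\<^sup>2"
      using norms False by (simp add: power_mult_distrib)
    then show ?thesis using c by simp
  qed
  then show ?thesis using w' by (simp add: outer_scaleR)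
qed

text \<open>Whether \<open>outer u\<close> lies below the identity depends on |u| only, and norms
  are preserved.\<close>

lemma image_mat1: "\<phi> (mat 1) = mat 1"
proof (rule eq_if_outer_minorants)
  show "psd (\<phi> (mat 1))" by (simp add: \<phi>_pd positive_definite_imp_psd)
  fix w
  obtain u where u: "ext (outer u) (outer w)" using ext_outer_surj .
  show "outer w \<preceq> \<phi> (mat 1) \<longleftrightarrow> outer w \<preceq> mat 1"
    using ext_outer_le_iff[OF u, of "mat 1"] ext_outer_norm[OF u] by (simp add: outer_le_mat1_iff)
qed simp

text \<open>A rank one perturbation of the identity is sent to one of the same kind, and the largest
  multiple of a rank one projection below it reveals the angle between the two vectors.\<close>

lemma ext_outer_cinner:
  assumes uw: "ext (outer u) (outer w)" and vv': "ext (outer v) (outer v')"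
  shows "cmod (cinner w v') = cmod (cinner u v)"
proof (cases "v = 0")
  case True
  then show ?thesis using ext_outer_norm[OF vv'] by simp
next
  case False
  \<comment> \<open>z is so far unrelated to v'; the goal of what follows is that they agree up to a
    phase.\<close>
  obtain z where z: "\<phi> (mat 1 + outer v) = mat 1 + outer z"
    using image_plus_outer[OF positive_definite_mat1, of v] image_mat1 by metis
  have pd: "positive_definite (mat 1 + outer v)" by (intro positive_definite_add_psd) simp_all
  define p q where "p = 1 + (norm v)\<^sup>2" and "q = 1 + (norm z)\<^sup>2"
  have pq: "0 < p" "0 < q" unfolding p_def q_def by (metis add_pos_nonneg zero_le_power2 zero_less_one)+
  have key: "(cmod (cinner u v))\<^sup>2 / p = (cmod (cinner w z))\<^sup>2 / q"
    if uw: "ext (outer u) (outer w)" for u w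
  proof -
    \<comment> \<open>\<open>t\<^sup>2 * g \<le> 1\<close> tells which multiples of u stay below the
      perturbed identity, and h does the same for w.\<close>
    define g where "g = (norm u)\<^sup>2 - (cmod (cinner u v))\<^sup>2 / p"
    define h where "h = (norm w)\<^sup>2 - (cmod (cinner w z))\<^sup>2 / q"
    have scaled: "t\<^sup>2 * g \<le> 1 \<longleftrightarrow> t\<^sup>2 * h \<le> 1" if t: "0 < t" for t
    proof -
      have "outer (t *\<^sub>R u) \<preceq> mat 1 + outer v \<longleftrightarrow> outer (t *\<^sub>R w) \<preceq> mat 1 + outer z"
        using ext_outer_le_iff[OF ext_outer_scaleR[OF uw t] pd] by (simp add: z)
      then show ?thesis
        unfolding outer_le_mat1_plus_outer_iff
        by (simp add: g_def h_def p_def q_def norm_mult power_mult_distrib right_diff_distrib)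
    qed
    have nonneg: "0 \<le> (norm x)\<^sup>2 - (cmod (cinner x y))\<^sup>2 / (1 + (norm y)\<^sup>2)" for x y :: "complex ^ 'n"
    proof -
      have "(cmod (cinner x y))\<^sup>2 \<le> (norm x)\<^sup>2 * (1 + (norm y)\<^sup>2)"
        using power_mono[OF cmod_cinner_le[of x y], of 2]
        by (simp add: power_mult_distrib distrib_left add_increasing)
      moreover have "0 < 1 + (norm y)\<^sup>2" by (metis add_pos_nonneg zero_le_power2 zero_less_one)
      ultimately show ?thesis by (simp add: pos_divide_le_eq)
    qed
    have gh: "0 \<le> g" "0 \<le> h" unfolding g_def h_def p_def q_def by (rule nonneg)+
    have "g = h"
    proof (rule ccontr)
      assume ne: "g \<noteq> h"
      \<comment> \<open>This scale separates g from h: the two inequalities become g \<le> h and h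
        \<le> g.\<close>
      define t where "t = sqrt (2 / (g + h))"
      have pos: "0 < g + h" using gh ne by linarith
      then have t: "0 < t" "t\<^sup>2 = 2 / (g + h)" by (simp_all add: t_def)
      show False using scaled[OF t(1)] pos ne unfolding t(2)
        by (simp add: pos_divide_le_eq) (metis nle_le)
    qed
    then show ?thesis using ext_outer_norm[OF uw] by (simp add: g_def h_def)
  qed
  have nv': "norm v' = norm v" using ext_outer_norm[OF vv'] .
  have vz: "cmod (cinner v' z) \<le> norm v * norm z"
    using cmod_cinner_le[of v' z] nv' by simp
  \<comment> \<open>\<open>key\<close> at v, with Cauchy-Schwarz, compares |v|^2 / (1 + |v|^2) with
    |z|^2 / (1 + |z|^2), and x / (1 + x) is increasing.\<close>
  have "norm v \<le> norm z"
  proof -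
    have "(norm v)\<^sup>2 * (norm v)\<^sup>2 / p \<le> (norm v)\<^sup>2 * (norm z)\<^sup>2 / q"
    proof -
      have "(norm v)\<^sup>2 * (norm v)\<^sup>2 / p = (cmod (cinner v' z))\<^sup>2 / q"
        using key[OF vv'] by (simp add: cmod_cinner_self power2_eq_square)
      also have "\<dots> \<le> (norm v * norm z)\<^sup>2 / q"
        using vz pq by (intro divide_right_mono power_mono) auto
      finally show ?thesis by (simp add: power_mult_distrib)
    qed
    then have "(norm v)\<^sup>2 / p \<le> (norm z)\<^sup>2 / q"
      using False by (metis mult_le_cancel_left_pos times_divide_eq_right zero_less_norm_iff zero_less_power)
    then have "(norm v)\<^sup>2 * q \<le> (norm z)\<^sup>2 * p"
      using pq by (simp add: field_simps)
    then have "(norm v)\<^sup>2 \<le> (norm z)\<^sup>2" by (simp add: p_def q_def algebra_simps)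
    then show ?thesis by (rule power2_le_imp_le) simp
  qed
  \<comment> \<open>The same with the roles of v and z exchanged, by \<open>key\<close> at a
    preimage of \<open>outer z\<close>.\<close>
  moreover have "norm z \<le> norm v"
  proof -
    have z0: "z \<noteq> 0" using \<open>norm v \<le> norm z\<close> False by auto
    obtain u0 where u0: "ext (outer u0) (outer z)" using ext_outer_surj .
    have "(norm z)\<^sup>2 * (norm z)\<^sup>2 / q \<le> (norm z)\<^sup>2 * (norm v)\<^sup>2 / p"
    proof -
      have "(norm z)\<^sup>2 * (norm z)\<^sup>2 / q = (cmod (cinner u0 v))\<^sup>2 / p"
        using key[OF u0] by (simp add: cmod_cinner_self power2_eq_square)
      also have "\<dots> \<le> (norm z * norm v)\<^sup>2 / p"
        using cmod_cinner_le[of u0 v] ext_outer_norm[OF u0] pq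
        by (intro divide_right_mono power_mono) auto
      finally show ?thesis by (simp add: power_mult_distrib)
    qed
    then have "(norm z)\<^sup>2 / q \<le> (norm v)\<^sup>2 / p"
      using z0 by (metis mult_le_cancel_left_pos times_divide_eq_right zero_less_norm_iff zero_less_power)
    then have "(norm z)\<^sup>2 * p \<le> (norm v)\<^sup>2 * q"
      using pq by (simp add: field_simps)
    then have "(norm z)\<^sup>2 \<le> (norm v)\<^sup>2" by (simp add: p_def q_def algebra_simps)
    then show ?thesis by (rule power2_le_imp_le) simp
  qed
  ultimately have nz: "norm z = norm v" by simp
  have eq: "cmod (cinner u v) = cmod (cinner w z)" if "ext (outer u) (outer w)" for u w
    using key[OF that] nz pq(1) by (simp add: p_def q_def power2_eq_iff_nonneg)
  \<comment> \<open>Now that the norms agree, \<open>key\<close> at v is the equality case of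
    Cauchy-Schwarz.\<close>
  have "outer v' = outer z"
    using eq[OF vv'] nv' nz
    by (intro outer_eq_if_cauchy_schwarz_eq) (simp_all add: cmod_cinner_self power2_eq_square)
  then have "qf (outer v') w = qf (outer z) w" by simp
  then show ?thesis using eq[OF uw] by (simp add: qf_outer power2_eq_iff_nonneg)
qed

end

section \<open>Conjugation by unitary and antiunitary operators\<close>

definition cnjm :: "complex ^ 'n ^ 'm \<Rightarrow> complex ^ 'n ^ 'm" where
  "cnjm A = (\<chi> i j. cnj (A $ i $ j))"

lemma cnjv_cnjv [simp]: "cnjv (cnjv x) = x"
  by (simp add: cnjv_def vec_eq_iff)

lemma cnjm_cnjm [simp]: "cnjm (cnjm A) = A"
  by (simp add: cnjm_def vec_eq_iff)

lemma cinner_cnjv: "cinner (cnjv x) (cnjv y) = cnj (cinner x y)"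
  by (simp add: cinner_def cnjv_def)

lemma cnjm_mv: "cnjm A *v cnjv x = cnjv (A *v x)"
  by (simp add: cnjm_def cnjv_def matrix_vector_mult_def vec_eq_iff)

lemma cnjv_mv_cnjv: "cnjv (A *v cnjv x) = cnjm A *v x"
  using cnjm_mv[of A "cnjv x"] by simp

lemma outer_cnjv: "outer (cnjv u) = cnjm (outer u)"
  by (simp add: outer_def cnjm_def cnjv_def vec_eq_iff)

lemma psd_cnjm: "psd A \<Longrightarrow> psd (cnjm A)"
proof -
  assume A: "psd A"
  have "ctranspose (cnjm A) = cnjm (ctranspose A)"
    by (simp add: ctranspose_def cnjm_def vec_eq_iff)
  moreover have "qf (cnjm A) x = qf A (cnjv x)" for x
    using cnjm_mv[of A "cnjv x"] cinner_cnjv[of "A *v cnjv x" "cnjv x"] by (simp add: qf_def)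
  ultimately show ?thesis using A by (simp add: psd_def)
qed

lemma cnjm_le_iff: "cnjm A \<preceq> cnjm B \<longleftrightarrow> A \<preceq> B"
proof -
  have "cnjm B - cnjm A = cnjm (B - A)" by (simp add: cnjm_def vec_eq_iff)
  then show ?thesis using psd_cnjm[of "B - A"] psd_cnjm[of "cnjm (B - A)"] by (auto simp: loewner_def)
qed

lemma psd_conjugate:
  assumes "psd A"
  shows "psd (V ** A ** ctranspose V)"
proof -
  have "qf (V ** A ** ctranspose V) x = qf A (ctranspose V *v x)" for x
    by (simp add: qf_def cinner_mult_mv flip: matrix_vector_mul_assoc)
  then show ?thesis
    using assms by (simp add: psd_def ctranspose_mult matrix_mul_assoc)
qed

lemma matrix_diff_conjugate:
  "V ** (B - A) ** W = V ** B ** W - V ** A ** W" for V A B W :: "complex ^ 'n ^ 'n"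
  by (simp add: vec_eq_iff matrix_matrix_mult_def sum_subtractf algebra_simps sum_distrib_left sum_distrib_right)

lemma unitary_conjugate_le_iff:
  assumes "unitary_matrix V"
  shows "V ** A ** ctranspose V \<preceq> V ** B ** ctranspose V \<longleftrightarrow> A \<preceq> B"
proof -
  have "ctranspose V ** (V ** C ** ctranspose V) ** V = C" for C
  proof -
    have "ctranspose V ** (V ** C ** ctranspose V) ** V = (ctranspose V ** V) ** C ** (ctranspose V ** V)"
      by (simp add: matrix_mul_assoc)
    then show ?thesis using assms by (simp add: unitary_matrix_def)
  qed
  then show ?thesis
    using psd_conjugate[of "B - A" V] psd_conjugate[of "V ** (B - A) ** ctranspose V" "ctranspose V"]
    by (auto simp: loewner_def simp flip: matrix_diff_conjugate)
qed

context jensen_automorphism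
begin

lemma image_eq_conjugate:
  obtains V where "unitary_matrix V"
    "(\<forall>A. positive_definite A \<longrightarrow> \<phi> A = V ** A ** ctranspose V) \<or>
     (\<forall>A. positive_definite A \<longrightarrow> \<phi> A = V ** cnjm A ** ctranspose V)"
proof -
  have "\<forall>u. \<exists>w. ext (outer u) (outer w)" using ext_outer_total by metis
  \<comment> \<open>\<open>outer w\<close> fixes w only up to a phase; any choice will do, since
    \<open>wigner\<close> asks about moduli only.\<close>
  then obtain T where T: "\<And>u. ext (outer u) (outer (T u))" by metis
  have "cmod (cinner (T x) (T y)) = cmod (cinner x y)" for x y
    using ext_outer_cinner T by blast
  then obtain V where V: "unitary_matrix V" and
    VT: "(\<forall>x. outer (T x) = outer (V *v x)) \<or> (\<forall>x. outer (T x) = outer (V *v cnjv x))"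
    by (rule wigner)
  \<comment> \<open>C stands for the identity in the unitary case and for \<open>cnjm\<close> in the
    antiunitary one.\<close>
  have image: "\<phi> A = V ** C A ** ctranspose V"
    if A: "positive_definite A" and C_psd: "psd (C A)"
      and C_le: "\<And>u. C (outer u) \<preceq> C A \<longleftrightarrow> outer u \<preceq> A"
      and CT: "\<And>u. outer (T u) = V ** C (outer u) ** ctranspose V" for A and C :: "complex ^ 'n ^ 'n \<Rightarrow> complex ^ 'n ^ 'n"
  proof (rule eq_if_outer_minorants)
    show "psd (\<phi> A)" using A by (simp add: \<phi>_pd positive_definite_imp_psd)
    show "psd (V ** C A ** ctranspose V)" using C_psd by (rule psd_conjugate)
    fix w
    obtain u where u: "ext (outer u) (outer w)" using ext_outer_surj .
    then have w: "outer w = outer (T u)" using T ext_unique by blast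
    have "outer w \<preceq> \<phi> A \<longleftrightarrow> outer u \<preceq> A" using ext_outer_le_iff[OF u A] by simp
    also have "\<dots> \<longleftrightarrow> outer w \<preceq> V ** C A ** ctranspose V"
      by (simp add: w CT unitary_conjugate_le_iff[OF V] C_le)
    finally show "outer w \<preceq> \<phi> A \<longleftrightarrow> outer w \<preceq> V ** C A ** ctranspose V" .
  qed
  have "(\<forall>A. positive_definite A \<longrightarrow> \<phi> A = V ** A ** ctranspose V) \<or>
     (\<forall>A. positive_definite A \<longrightarrow> \<phi> A = V ** cnjm A ** ctranspose V)"
    using VT
  proof
    assume "\<forall>x. outer (T x) = outer (V *v x)"
    then show ?thesis
      using image[of _ "\<lambda>A. A"] by (simp add: outer_mv_conj positive_definite_imp_psd)
  next
    assume "\<forall>x. outer (T x) = outer (V *v cnjv x)"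
    then show ?thesis
      using image[of _ cnjm]
      by (simp add: positive_definite_imp_psd psd_cnjm cnjm_le_iff outer_mv_conj[symmetric] outer_cnjv)
  qed
  then show ?thesis using V that by blast
qed

end

lemma unitary_op_matrix:
  fixes V :: "complex ^ 'n ^ 'n"
  assumes V: "unitary_matrix V"
  shows "unitary_op ((*v) V) \<and> is_adjoint ((*v) V) ((*v) (ctranspose V))"
proof -
  have "bij ((*v) V)"
    by (rule o_bij[of "(*v) (ctranspose V)"])
      (use V in \<open>auto simp: fun_eq_iff matrix_vector_mul_assoc unitary_matrix_def\<close>)
  then show ?thesis
    using V by (simp add: unitary_op_def is_adjoint_def matrix_vector_mul_linear_gen cinner_mult_mv
        matrix_vector_mul_assoc unitary_matrix_def)
qed

lemma antiunitary_op_matrix: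
  fixes V :: "complex ^ 'n ^ 'n"
  assumes V: "unitary_matrix V"
  shows "antiunitary_op (\<lambda>x. V *v cnjv x) \<and>
    is_conj_adjoint (\<lambda>x. V *v cnjv x) (\<lambda>y. cnjv (ctranspose V *v y))"
proof -
  have add: "cnjv (x + y) = cnjv x + cnjv y" and scale: "cnjv (c *s x) = cnj c *s cnjv x"
    for x y :: "complex ^ 'n" and c
    by (simp_all add: cnjv_def vec_eq_iff)
  have "bij (\<lambda>x. V *v cnjv x)"
    by (rule o_bij[of "\<lambda>y. cnjv (ctranspose V *v y)"])
      (use V in \<open>auto simp: fun_eq_iff matrix_vector_mul_assoc unitary_matrix_def\<close>)
  moreover have "cinner (V *v cnjv x) (V *v cnjv y) = cinner y x" for x y
    using V by (simp add: cinner_mult_mv matrix_vector_mul_assoc unitary_matrix_def cinner_cnjv cnj_cinner)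
  moreover have "cinner (V *v cnjv x) y = cinner (cnjv (ctranspose V *v y)) x" for x y
    using cinner_cnjv[of x "cnjv (ctranspose V *v y)"] by (simp add: cinner_mult_mv cnj_cinner)
  ultimately show ?thesis
    by (simp add: antiunitary_op_def is_conj_adjoint_def conj_linear_def add scale
        matrix_vector_right_distrib vector_scalar_commute)
qed

text \<open>Convexity passes to the closed half-line by letting the left end point tend to 0 in the
  inequality for f.\<close>

lemma jensen_function_extension:
  fixes f :: "real \<Rightarrow> real"
  assumes diff: "f differentiable_on {0<..}" and strict: "strictly_convex_on {0<..} f"
    and lim: "(f \<longlongrightarrow> c) (at_right 0)" and unb: "\<not> bdd_above (deriv f ` {0<..})"
    and l: "0 < l" "l < 1"
  shows "jensen_function (\<lambda>x. if x \<le> 0 then c else f x) (deriv f) l"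
proof -
  define F where "F x = (if x \<le> 0 then c else f x)" for x
  have f_deriv: "(f has_real_derivative deriv f x) (at x)" if "0 < x" for x
  proof -
    have "f differentiable (at x within {0<..})" using diff that by (simp add: differentiable_on_def)
    then have "f differentiable at x" using that at_within_open[of x "{0<..}"] by simp
    then show ?thesis by (simp add: DERIV_deriv_iff_real_differentiable)
  qed
  have f_strict: "f (t * x + (1 - t) * y) < t * f x + (1 - t) * f y"
    if "0 < x" "0 < y" "x \<noteq> y" "0 < t" "t < 1" for x y t
    using strict that by (simp add: strictly_convex_on_def)
  have f_convex: "convex_on {0<..} f"
  proof (rule convex_on_linorderI)
    fix t x y :: real assume "0 < t" "t < 1" "x \<in> {0<..}" "y \<in> {0<..}" "x < y"
    then show "f ((1 - t) *\<^sub>R x + t *\<^sub>R y) \<le> (1 - t) * f x + t * f y"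
      using f_strict[of x y "1 - t"] by simp
  qed simp
  have tangent: "deriv f x * (y - x) \<le> f y - f x" if "0 < x" "0 < y" for x y
    by (rule convex_on_imp_above_tangent[OF f_convex])
      (use that f_deriv in \<open>auto intro: has_field_derivative_at_within simp: interior_open\<close>)
  have F_deriv: "(F has_real_derivative deriv f x) (at x)" if "0 < x" for x
    by (rule has_field_derivative_transform_within_open[OF f_deriv, of x "{0<..}"])
      (use that in \<open>auto simp: F_def\<close>)
  have F_lim: "(F \<longlongrightarrow> F 0) (at_right 0)"
  proof -
    have "\<forall>\<^sub>F x in at_right 0. f x = F x"
      by (auto simp: eventually_at_right_field F_def intro: exI[of _ 1])
    with lim have "(F \<longlongrightarrow> c) (at_right 0)" by (rule Lim_transform_eventually)
    then show ?thesis by (simp add: F_def)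
  qed
  have F_cont: "continuous_on {0..} F"
  proof (rule continuous_on_eq_continuous_within[THEN iffD2, rule_format])
    fix x :: real assume "x \<in> {0..}"
    then consider "x = 0" | "0 < x" by fastforce
    then show "continuous (at x within {0..}) F"
    proof cases
      case 1
      then show ?thesis
        using F_lim by (simp add: continuous_within at_within_Ici_at_right)
    next
      case 2
      then show ?thesis
        using F_deriv DERIV_isCont continuous_at_imp_continuous_at_within by blast
    qed
  qed
  have F_convex: "convex_on {0..} F"
  proof (rule convex_on_linorderI)
    fix t x y :: real assume *: "0 < t" "t < 1" "x \<in> {0..}" "y \<in> {0..}" "x < y"
    show "F ((1 - t) *\<^sub>R x + t *\<^sub>R y) \<le> (1 - t) * F x + t * F y"
    proof (cases "x = 0")
      case False
      then have "0 < x" "0 < y" "0 < (1 - t) * x + t * y" using * by (auto intro: add_pos_pos)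
      then show ?thesis using f_strict[of x y "1 - t"] * by (simp add: F_def)
    next
      case True
      have ty: "0 < t * y" using * by simp
      have lim1: "((\<lambda>e. F ((1 - t) * e + t * y)) \<longlongrightarrow> F ((1 - t) * 0 + t * y)) (at_right 0)"
      proof (rule isCont_tendsto_compose[of _ F])
        show "isCont F ((1 - t) * 0 + t * y)" using F_deriv[OF ty] DERIV_isCont by simp
      qed (intro tendsto_intros)
      have lim2: "((\<lambda>e. (1 - t) * F e + t * F y) \<longlongrightarrow> (1 - t) * F 0 + t * F y) (at_right 0)"
        using F_lim by (intro tendsto_intros)
      have "\<forall>\<^sub>F e in at_right 0. F ((1 - t) * e + t * y) \<le> (1 - t) * F e + t * F y"
      proof -
        have "F ((1 - t) * e + t * y) \<le> (1 - t) * F e + t * F y" if "0 < e" "e < y" for e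
        proof -
          have "0 < (1 - t) * e + t * y" using * that by (auto intro: add_pos_pos)
          then show ?thesis using f_strict[of e y "1 - t"] * that by (simp add: F_def)
        qed
        then show ?thesis using * by (auto simp: eventually_at_right_field intro!: exI[of _ y])
      qed
      from tendsto_le[OF _ lim2 lim1 this] show ?thesis
        using True by simp
    qed
  qed simp
  have deriv_mono: "deriv f x < deriv f y" if "0 < x" "x < y" for x y
  proof -
    \<comment> \<open>The tangent at x is tested at the midpoint, where convexity is strict; the
      tangent at y bounds the slope of the chord from above.\<close>
    define m where "m = (1 / 2) * x + (1 - 1 / 2) * y"
    have "f m < (1 / 2) * f x + (1 - 1 / 2) * f y"
      unfolding m_def using that by (intro f_strict) auto
    moreover have "deriv f x * (m - x) \<le> f m - f x" "deriv f y * (x - y) \<le> f x - f y"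
      using that by (intro tangent, simp_all add: m_def)+
    moreover have "m - x = (y - x) / 2" by (simp add: m_def field_simps)
    moreover have "deriv f y * (x - y) = - (deriv f y * (y - x))" by (simp add: algebra_simps)
    ultimately have "deriv f x * (y - x) < deriv f y * (y - x)" by simp
    then show ?thesis using that by simp
  qed
  have "\<exists>x>0. b < deriv f x" for b
    using unb by (auto simp: bdd_above_def not_le)
  then show ?thesis
    unfolding F_def[abs_def, symmetric]
    using F_convex F_cont F_deriv deriv_mono l by unfold_locales auto
qed

lemma trf_cong_positive_definite:
  assumes "positive_definite A" "\<And>x. 0 < x \<Longrightarrow> g x = h x"
  shows "trf g A = trf h A"
proof -
  obtain U d where A: "diagonalises U d A"
    using assms(1) positive_definite_iff hermitian_diagonalises by blast
  show ?thesis
    using assms(2) diagonalises_positive_definite[OF A assms(1)] by (simp add: trf_eq[OF A])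
qed

text \<open>The conclusion compares maps on vectors because an antiunitary operator is not given by
  a complex matrix.\<close>

theorem theorem5:
  fixes f :: "real \<Rightarrow> real" and l :: real
    and \<phi> :: "complex ^ 'n ^ 'n \<Rightarrow> complex ^ 'n ^ 'n"
  assumes "f differentiable_on {0<..}"
    and "strictly_convex_on {0<..} f"
    and "\<exists>c. (f \<longlongrightarrow> c) (at_right 0)"
    and "\<not> bdd_above (deriv f ` {0<..})"
    and "0 < l" and "l < 1"
    and "\<phi> ` Collect positive_definite = Collect positive_definite"
    and "\<And>A B. positive_definite A \<Longrightarrow> positive_definite B \<Longrightarrow>
           jensen_div f l (\<phi> A) (\<phi> B) = jensen_div f l A B"
  shows "\<exists>U U'. (unitary_op U \<and> is_adjoint U U' \<or> antiunitary_op U \<and> is_conj_adjoint U U') \<and>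
           (\<forall>A. positive_definite A \<longrightarrow> (\<lambda>x. \<phi> A *v x) = U \<circ> (\<lambda>x. A *v x) \<circ> U')"
proof -
  obtain c where c: "(f \<longlongrightarrow> c) (at_right 0)" using assms(3) by blast
  define F where "F x = (if x \<le> 0 then c else f x)" for x
  interpret jensen_function F "deriv f" l
    unfolding F_def using assms(1,2,4-6) c by (intro jensen_function_extension)
  have \<phi>_pd: "positive_definite (\<phi> A)" if "positive_definite A" for A
    using assms(7) that by auto
  have J_eq: "Re (jensen_div f l A B) = J A B" if "positive_definite A" "positive_definite B"
    for A B :: "complex ^ 'n ^ 'n"
  proof -
    have "trf f C = trf F C" if "positive_definite C" for C :: "complex ^ 'n ^ 'n"
      using that by (rule trf_cong_positive_definite) (simp add: F_def)
    then show ?thesis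
      using that positive_definite_mix[OF that]
      by (simp add: jensen_div_def J_def trf_def trace_add trace_sub trace_scaleR)
  qed
  have J_image: "J (\<phi> A) (\<phi> B) = J A B" if "positive_definite A" "positive_definite B"
    for A B :: "complex ^ 'n ^ 'n"
    using assms(8)[OF that] J_eq that \<phi>_pd by metis
  have le_iff: "\<phi> A \<preceq> \<phi> B \<longleftrightarrow> A \<preceq> B" if AB: "positive_definite A" "positive_definite B"
    for A B
  proof -
    \<comment> \<open>Surjectivity lets X range over images, so that preservation of J carries the
      boundedness criterion from A, B to \<phi> A, \<phi> B.\<close>
    have "(\<forall>X. positive_definite X \<longrightarrow> P (\<phi> X)) \<longleftrightarrow> (\<forall>X. positive_definite X \<longrightarrow> P X)" for P
      using assms(7) by (metis (no_types, lifting) image_iff mem_Collect_eq)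
    from this[of "\<lambda>X. k \<le> J X (\<phi> A) - J X (\<phi> B)" for k] show ?thesis
      using AB by (simp add: loewner_iff_J_bounded \<phi>_pd J_image)
  qed
  \<comment> \<open>Antisymmetry of the order yields injectivity, and with it the inverse that the
    locale asks for.\<close>
  have inj: "inj_on \<phi> (Collect positive_definite)"
  proof (rule inj_onI)
    fix A B assume AB: "A \<in> Collect positive_definite" "B \<in> Collect positive_definite" "\<phi> A = \<phi> B"
    then have "A \<preceq> B" "B \<preceq> A" using le_iff[of A B] le_iff[of B A] by simp_all
    then show "A = B" using AB by (intro loewner_antisym positive_definite_imp_psd) simp_all
  qed
  interpret jensen_automorphism F "deriv f" l \<phi> "inv_into (Collect positive_definite) \<phi>"
  proof unfold_locales
    fix A :: "complex ^ 'n ^ 'n" assume A: "positive_definite A"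
    then have "A \<in> \<phi> ` Collect positive_definite" using assms(7) by simp
    from inv_into_into[OF this] f_inv_into_f[OF this]
    show "positive_definite (inv_into (Collect positive_definite) \<phi> A)"
      and "\<phi> (inv_into (Collect positive_definite) \<phi> A) = A"
      by simp_all
    show "inv_into (Collect positive_definite) \<phi> (\<phi> A) = A"
      using A inj by (simp add: inv_into_f_f)
  qed (simp_all add: \<phi>_pd le_iff J_image)
  obtain V where V: "unitary_matrix V" and
    image: "(\<forall>A. positive_definite A \<longrightarrow> \<phi> A = V ** A ** ctranspose V) \<or>
     (\<forall>A. positive_definite A \<longrightarrow> \<phi> A = V ** cnjm A ** ctranspose V)"
    by (rule image_eq_conjugate)
  from image show ?thesis
  proof
    assume *: "\<forall>A. positive_definite A \<longrightarrow> \<phi> A = V ** A ** ctranspose V"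
    show ?thesis
      by (rule exI[of _ "(*v) V"], rule exI[of _ "(*v) (ctranspose V)"])
        (simp add: * unitary_op_matrix[OF V] fun_eq_iff matrix_vector_mul_assoc matrix_mul_assoc)
  next
    assume *: "\<forall>A. positive_definite A \<longrightarrow> \<phi> A = V ** cnjm A ** ctranspose V"
    show ?thesis
      by (rule exI[of _ "\<lambda>x. V *v cnjv x"], rule exI[of _ "\<lambda>y. cnjv (ctranspose V *v y)"])
        (simp add: * antiunitary_op_matrix[OF V] fun_eq_iff matrix_vector_mul_assoc matrix_mul_assoc cnjv_mv_cnjv)
  qed
qed

end
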